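(* Let $\{\boldsymbol{X}_k : k=1,2,3,\dots\}$ be an adapted sequence of random self-adjoint matrices of dimension $d$ that satisfy, for a constant $R>0$, the relations $$\mathbb{E}_{k-1}\boldsymbol{X}_k=\boldsymbol{0}\quad\text{and}\quad \lambda_{\max}(\boldsymbol{X}_k)\leq R\quad\text{almost surely, for } k=1,2,3,\dots.$$ Define the partial sums $$\boldsymbol{Y}_k := \sum_{j=1}^k \boldsymbol{X}_j\quad\text{and}\quad \boldsymbol{W}_k := \sum_{j=1}^k \mathbb{E}_{j-1}\big(\boldsymbol{X}_j^2\big)\quad\text{for } k=0,1,2,\dots.$$ Then, for all $t\geq 0$ and $\sigma^2>0$, $$\mathbb{P}\left\{\exists\, k\geq 0 : \lambda_{\max}(\boldsymbol{Y}_k)\geq t\ \text{ and }\ \|\boldsymbol{W}_k\|\leq\sigma^2\right\}\leq d\cdot\exp\left\{-\frac{\sigma^2}{R^2}\cdot h\!\left(\frac{Rt}{\sigma^2}\right)\right\},$$ where $h(u):=(1+u)\log(1+u)-u$ for $u\geq 0$.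
   Context: Let $(\Omega,\mathscr{F},\mathbb{P})$ be a probability space with a filtration $\mathscr{F}_0\subset\mathscr{F}_1\subset\mathscr{F}_2\subset\dots\subset\mathscr{F}$; $\mathbb{E}_k$ denotes expectation conditioned on $\mathscr{F}_k$. A sequence $\{\boldsymbol{X}_k\}$ of random matrices is adapted when each $\boldsymbol{X}_k$ is $\mathscr{F}_k$-measurable. Self-adjoint means Hermitian; $\lambda_{\max}$ is the algebraically largest eigenvalue of a self-adjoint matrix; $\|\cdot\|$ is the spectral norm (largest singular value). Empty sums are zero, so $\boldsymbol{Y}_0=\boldsymbol{W}_0=\boldsymbol{0}$. The conditional expectations $\mathbb{E}_{k-1}\boldsymbol{X}_k$ and $\mathbb{E}_{j-1}(\boldsymbol{X}_j^2)$ used in the statement are assumed to exist. *)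

theory Defs
  imports "HOL-Probability.Probability"
begin

type_synonym 'n cmat = "complex ^ 'n ^ 'n"

definition conj_transpose :: "'n::finite cmat \<Rightarrow> 'n cmat" where
  "conj_transpose A = map_matrix cnj (transpose A)"

definition self_adjoint :: "'n::finite cmat \<Rightarrow> bool" where
  "self_adjoint A \<longleftrightarrow> conj_transpose A = A"

definition eigenvalues :: "'n::finite cmat \<Rightarrow> complex set" where
  "eigenvalues A = {c. \<exists>v. v \<noteq> 0 \<and> A *v v = c *s v}"

(* Meaningful for self-adjoint A, where every eigenvalue is real and the set is
   finite and nonempty. *)
definition lambda_max :: "'n::finite cmat \<Rightarrow> real" where
  "lambda_max A = Max {x. complex_of_real x \<in> eigenvalues A}"

definition singular_values :: "'n::finite cmat \<Rightarrow> real set" where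
  "singular_values A =
     {s. s \<ge> 0 \<and> complex_of_real (s\<^sup>2) \<in> eigenvalues (conj_transpose A ** A)}"

definition spectral_norm :: "'n::finite cmat \<Rightarrow> real" where
  "spectral_norm A = Max (singular_values A)"

(* Entrywise conditional expectation, real and imaginary parts separately; a version of
   the conditional expectation whenever Z is integrable with respect to M. *)
definition mat_cond_exp ::
    "'a measure \<Rightarrow> 'a measure \<Rightarrow> ('a \<Rightarrow> 'n::finite cmat) \<Rightarrow> 'a \<Rightarrow> 'n cmat" where
  "mat_cond_exp M G Z \<omega> =
     (\<chi> i j. Complex (real_cond_exp M G (\<lambda>\<omega>. Re (Z \<omega> $ i $ j)) \<omega>)
                    (real_cond_exp M G (\<lambda>\<omega>. Im (Z \<omega> $ i $ j)) \<omega>))"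

definition partial_sum :: "(nat \<Rightarrow> 'a \<Rightarrow> 'n::finite cmat) \<Rightarrow> nat \<Rightarrow> 'a \<Rightarrow> 'n cmat" where
  "partial_sum X k \<omega> = (\<Sum>j = 1..k. X j \<omega>)"

definition quadratic_variation ::
    "'a measure \<Rightarrow> (nat \<Rightarrow> 'a measure) \<Rightarrow> (nat \<Rightarrow> 'a \<Rightarrow> 'n::finite cmat) \<Rightarrow> nat \<Rightarrow> 'a \<Rightarrow> 'n cmat" where
  "quadratic_variation M F X k \<omega> =
     (\<Sum>j = 1..k. mat_cond_exp M (F (j - 1)) (\<lambda>\<omega>. X j \<omega> ** X j \<omega>) \<omega>)"

definition h :: "real \<Rightarrow> real" where
  "h u = (1 + u) * ln (1 + u) - u"

end

theory Submission
  imports Defs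
begin

text \<open>Write \<open>\<theta> > 0\<close>, \<open>g = (e\<^sup>\<theta>\<^sup>R - \<theta> R - 1) / R\<^sup>2\<close> and \<open>Z\<^sub>k = tr exp (\<theta> Y\<^sub>k - g W\<^sub>k)\<close>. On the event in question some
  \<open>Z\<^sub>k\<close> is at least \<open>exp (\<theta> t - g \<sigma>\<^sup>2)\<close>, so the bound follows from the maximal inequality once \<open>Z\<close> is
  a supermartingale, with the choice \<open>\<theta> = ln (1 + R t / \<sigma>\<^sup>2) / R\<close>.

  The supermartingale property rests on Lieb's theorem: \<open>A \<mapsto> tr exp (K + ln A)\<close> is concave.
  By the Gibbs variational principle \<open>tr exp (K + ln A)\<close> is the supremum over positive definite
  \<open>S\<close> of \<open>tr S K + tr S - D(S, A)\<close> with \<open>D(S, A) = tr S ln S - tr S ln A\<close>, so concavity follows from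
  joint convexity of \<open>D\<close>; and \<open>D\<close> is an integral of functions that are, up to affine terms,
  suprema of functionals linear in \<open>(S, A)\<close>. Replacing Lieb's concave function by its tangent
  at \<open>1 + g V\<close>, where \<open>V\<close> is the conditional expectation of \<open>X\<^sup>2\<close>, leaves an expression linear in
  \<open>X\<close> and \<open>X\<^sup>2\<close>, whose conditional expectation is immediate.\<close>

section \<open>Spectral theorem\<close>

text \<open>For scalars the past factor could be pulled out of the conditional expectation; for
  non-commuting matrices \<open>exp (A + B)\<close> does not factor, and Lieb concavity takes the
  place of that step. The argument closes because, with H = \<theta> Y - g W the past exponent, the
  constant term of the tangent is \<open>tr exp (H - g V + ln (1 + g V))\<close>, which is at most
  \<open>tr exp H\<close> since ln (1 + x) \<le> x. The constant g is the least one with exp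
  (\<theta> x) \<le> 1 + \<theta> x + g x^2 for all x \<le> R, with equality at x = R, and \<theta>
  minimises g \<sigma>^2 - \<theta> t. Two obstacles shape the probabilistic part. The tangent
  depends on the random pair (H, V), so it is frozen on small sets of pairs at the cost of a factor
  close to 1. And integrability of Z is nowhere assumed, so the supermartingale property is stated
  by inequalities between nonnegative integrals over sets of the filtration.\<close>

abbreviation adj :: "'n::finite cmat \<Rightarrow> 'n cmat" where
  "adj \<equiv> conj_transpose"

lemma adj_nth [simp]: "adj A $ i $ j = cnj (A $ j $ i)"
  by (simp add: conj_transpose_def transpose_def)

lemma matrix_mult_nth: "(A ** B) $ i $ j = (\<Sum>k\<in>UNIV. A $ i $ k * B $ k $ j)"
  by (simp add: matrix_matrix_mult_def)

lemma adj_adj [simp]: "adj (adj A) = A"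
  by (simp add: vec_eq_iff)

lemma adj_mult: "adj (A ** B) = adj B ** adj A"
  by (simp add: vec_eq_iff matrix_mult_nth mult.commute)

lemma adj_add: "adj (A + B) = adj A + adj B"
  by (simp add: vec_eq_iff)

lemma adj_diff: "adj (A - B) = adj A - adj B"
  by (simp add: vec_eq_iff)

lemma adj_scaleR: "adj (r *\<^sub>R A) = r *\<^sub>R adj A"
  by (simp add: vec_eq_iff)

lemma adj_zero [simp]: "adj 0 = 0"
  by (simp add: vec_eq_iff)

lemma adj_one [simp]: "adj (mat 1) = mat 1"
  by (simp add: vec_eq_iff mat_def)

lemma self_adjoint_add: "self_adjoint A \<Longrightarrow> self_adjoint B \<Longrightarrow> self_adjoint (A + B)"
  by (simp add: self_adjoint_def adj_add)

lemma self_adjoint_diff: "self_adjoint A \<Longrightarrow> self_adjoint B \<Longrightarrow> self_adjoint (A - B)"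
  by (simp add: self_adjoint_def adj_diff)

lemma self_adjoint_scaleR: "self_adjoint A \<Longrightarrow> self_adjoint (r *\<^sub>R A)"
  by (simp add: self_adjoint_def adj_scaleR)

lemma self_adjoint_zero: "self_adjoint 0"
  by (simp add: self_adjoint_def)

lemma self_adjoint_one: "self_adjoint (mat 1)"
  by (simp add: self_adjoint_def)

lemma self_adjoint_square: "self_adjoint A \<Longrightarrow> self_adjoint (A ** A)"
  by (simp add: self_adjoint_def adj_mult)

lemma self_adjoint_sum: "(\<And>i. i \<in> I \<Longrightarrow> self_adjoint (f i)) \<Longrightarrow> self_adjoint (sum f I)"
  by (induction I rule: infinite_finite_induct) (auto intro: self_adjoint_add self_adjoint_zero)

lemmas self_adjoint_intros =
  self_adjoint_add self_adjoint_diff self_adjoint_scaleR self_adjoint_zero self_adjoint_one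
  self_adjoint_square self_adjoint_sum

lemma self_adjointD: "self_adjoint A \<Longrightarrow> cnj (A $ i $ j) = A $ j $ i"
  by (metis adj_nth self_adjoint_def)

lemma matrix_add_rdistrib': "(A + B) ** C = A ** C + B ** (C :: 'n::finite cmat)"
  by (simp add: vec_eq_iff matrix_mult_nth algebra_simps sum.distrib)

lemma matrix_diff_rdistrib: "(A - B) ** C = A ** C - B ** (C :: 'n::finite cmat)"
  by (simp add: vec_eq_iff matrix_mult_nth algebra_simps sum_subtractf)

lemma matrix_diff_ldistrib: "C ** (A - B) = C ** A - C ** (B :: 'n::finite cmat)"
  by (simp add: vec_eq_iff matrix_mult_nth algebra_simps sum_subtractf)

lemma matrix_scaleR_left: "(r *\<^sub>R A) ** C = r *\<^sub>R (A ** (C :: 'n::finite cmat))"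
  by (simp add: vec_eq_iff matrix_mult_nth scaleR_right.sum)

lemma matrix_scaleR_right: "A ** (r *\<^sub>R C) = r *\<^sub>R (A ** (C :: 'n::finite cmat))"
  by (simp add: vec_eq_iff matrix_mult_nth scaleR_right.sum)

lemmas matrix_linear_simps =
  matrix_add_rdistrib' matrix_add_ldistrib matrix_diff_rdistrib matrix_diff_ldistrib
  matrix_scaleR_left matrix_scaleR_right

section \<open>Unitary and real diagonal matrices\<close>

definition unitary :: "'n::finite cmat \<Rightarrow> bool" where
  "unitary U \<longleftrightarrow> U ** adj U = mat 1"

lemma unitaryD: "unitary U \<Longrightarrow> U ** adj U = mat 1" "unitary U \<Longrightarrow> adj U ** U = mat 1"
  by (auto simp: unitary_def matrix_left_right_inverse)

lemma unitary_adj: "unitary U \<Longrightarrow> unitary (adj U)"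
  by (simp add: unitary_def matrix_left_right_inverse)

lemma unitary_mult: "unitary U \<Longrightarrow> unitary V \<Longrightarrow> unitary (U ** V)"
  unfolding unitary_def adj_mult by (metis matrix_mul_assoc matrix_mul_lid)

definition dg :: "('n::finite \<Rightarrow> real) \<Rightarrow> 'n cmat" where
  "dg l = (\<chi> i j. if i = j then complex_of_real (l i) else 0)"

lemma dg_mult: "dg l ** dg m = dg (\<lambda>i. l i * m i)"
  by (simp add: vec_eq_iff matrix_mult_nth dg_def if_distrib[of "\<lambda>x. x * _"] cong: if_cong)

lemma adj_dg [simp]: "adj (dg l) = dg l"
  by (auto simp: vec_eq_iff dg_def)

lemma dg_mult_left: "(dg l ** A) $ i $ j = of_real (l i) * A $ i $ j"
  by (simp add: matrix_mult_nth dg_def if_distrib[of "\<lambda>x. x * _"] cong: if_cong)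

lemma dg_mult_right: "(A ** dg l) $ i $ j = A $ i $ j * of_real (l j)"
  by (simp add: matrix_mult_nth dg_def if_distrib[of "\<lambda>x. _ * x"] cong: if_cong)

text \<open>Rows are treated as row vectors: entry (i, j) of \<open>U ** A ** adj V\<close> is this
  form at row i of U and row j of V, which turns diagonalisation into orthogonality statements about
  rows. The form is linear in the first argument and conjugate-linear in the second.\<close>

definition sq :: "'n::finite cmat \<Rightarrow> complex ^ 'n \<Rightarrow> complex ^ 'n \<Rightarrow> complex" where
  "sq A x y = (\<Sum>k\<in>UNIV. \<Sum>l\<in>UNIV. x $ k * A $ k $ l * cnj (y $ l))"

lemma sq_lin [simp]:
  "sq A (x + y) z = sq A x z + sq A y z"
  "sq A z (x + y) = sq A z x + sq A z y"
  "sq A (c *s x) z = c * sq A x z"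
  "sq A z (c *s x) = cnj c * sq A z x"
  "sq A (x - y) z = sq A x z - sq A y z"
  "sq A z (x - y) = sq A z x - sq A z y"
  by (simp_all add: sq_def algebra_simps sum.distrib sum_subtractf sum_distrib_left)

lemma sq_cnj: "self_adjoint A \<Longrightarrow> cnj (sq A x y) = sq A y x"
  unfolding sq_def by (subst sum.swap) (simp add: self_adjointD mult_ac)

lemma sandwich_nth: "(U ** A ** adj V) $ i $ j = sq A (U $ i) (V $ j)"
  unfolding sq_def by (subst sum.swap) (simp add: matrix_mult_nth sum_distrib_right)

lemma unitary_iff_sq: "unitary U \<longleftrightarrow> (\<forall>i j. sq (mat 1) (U $ i) (U $ j) = (if i = j then 1 else 0))"
proof -
  have "unitary U \<longleftrightarrow> U ** mat 1 ** adj U = mat 1" by (simp add: unitary_def)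
  also have "\<dots> \<longleftrightarrow> (\<forall>i j. sq (mat 1) (U $ i) (U $ j) = (if i = j then 1 else 0))"
    unfolding vec_eq_iff[of _ "mat 1"] vec_eq_iff[of "_ $ _"] sandwich_nth by (simp add: mat_def)
  finally show ?thesis .
qed

lemma continuous_on_sq [continuous_intros]:
  "continuous_on S f \<Longrightarrow> continuous_on S g \<Longrightarrow> continuous_on S (\<lambda>x. sq A (f x) (g x))"
  unfolding sq_def by (intro continuous_intros)

lemma norm_vec_le_sum: "norm x \<le> (\<Sum>i\<in>UNIV. norm (x $ i))"
  by (simp add: norm_vec_def L2_set_le_sum)

lemma unitary_entry_le:
  assumes "unitary U" shows "norm (U $ i $ j) \<le> 1"
proof -
  have "(\<Sum>k\<in>UNIV. of_real ((norm (U $ i $ k))\<^sup>2)) = (U ** adj U) $ i $ i"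
    by (simp add: matrix_mult_nth complex_norm_square[symmetric] del: of_real_power)
  also have "\<dots> = of_real 1" using unitaryD(1)[OF assms] by (simp add: mat_def)
  finally have *: "(\<Sum>k\<in>UNIV. (norm (U $ i $ k))\<^sup>2) = 1"
    by (simp only: of_real_sum[symmetric] of_real_eq_iff)
  have "(norm (U $ i $ j))\<^sup>2 \<le> (\<Sum>k\<in>UNIV. (norm (U $ i $ k))\<^sup>2)"
    by (rule member_le_sum) auto
  then show ?thesis unfolding * by (simp add: power_le_one_iff)
qed

lemma compact_unitary: "compact {U :: 'n::finite cmat. unitary U}"
proof -
  have "closed {U :: 'n cmat. unitary U}"
    unfolding unitary_iff_sq by (intro closed_Collect_all closed_Collect_eq continuous_intros)
  moreover have "bounded {U :: 'n cmat. unitary U}"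
    unfolding bounded_iff
  proof (intro exI ballI)
    fix U :: "'n cmat" assume "U \<in> {U. unitary U}"
    then have U: "unitary U" by simp
    have "norm U \<le> (\<Sum>i\<in>UNIV. norm (U $ i))" by (rule norm_vec_le_sum)
    also have "\<dots> \<le> (\<Sum>i\<in>UNIV. \<Sum>j\<in>UNIV. norm (U $ i $ j))"
      by (intro sum_mono norm_vec_le_sum)
    also have "\<dots> \<le> (\<Sum>i\<in>(UNIV::'n set). \<Sum>j\<in>(UNIV::'n set). 1)"
      by (intro sum_mono unitary_entry_le U)
    finally show "norm U \<le> (\<Sum>i\<in>(UNIV::'n set). \<Sum>j\<in>(UNIV::'n set). 1)" .
  qed
  ultimately show ?thesis by (simp add: compact_eq_bounded_closed)
qed

text \<open>A maximiser over the unitary group of the weighted diagonal sum, with distinct weights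
  \<open>c i\<close>, diagonalises \<open>A\<close>: otherwise rotating two rows would increase it.\<close>

lemma spectral_theorem_rows:
  fixes A :: "'n::finite cmat"
  assumes A: "self_adjoint A"
  obtains U where "unitary U" "\<And>i j. i \<noteq> j \<Longrightarrow> sq A (U $ i) (U $ j) = 0"
proof -
  obtain c :: "'n \<Rightarrow> nat" where c: "inj c"
    using finite_imp_inj_to_nat_seg[of "UNIV :: 'n set"] by auto
  define F where "F U = (\<Sum>i\<in>UNIV. real (c i) * Re (sq A (U $ i) (U $ i)))" for U :: "'n cmat"
  have ne: "{U :: 'n cmat. unitary U} \<noteq> {}"
    using unitary_def[of "mat 1 :: 'n cmat"] by auto
  have cF: "continuous_on {U :: 'n cmat. unitary U} F"
    unfolding F_def by (intro continuous_intros)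
  obtain U where U: "unitary U" and max: "\<And>V. unitary V \<Longrightarrow> F V \<le> F U"
    using continuous_attains_sup[OF compact_unitary ne cF] by blast
  \<comment> \<open>If this entry were nonzero, a rotation mixing rows i and j could move diagonal
    weight to row i, whose coefficient is the larger one.\<close>
  have off: "sq A (U $ j) (U $ i) = 0" if ij: "c j < c i" for i j
  proof (rule ccontr)
    assume nz: "sq A (U $ j) (U $ i) \<noteq> 0"
    define b where "b = sq A (U $ j) (U $ i)"
    \<comment> \<open>The phase w makes the off-diagonal entry real and positive, so that the
      first-order change of the diagonal under the rotation has a known sign.\<close>
    define w where "w = cnj b / of_real (norm b)"
    have b0: "norm b > 0" using nz by (simp add: b_def)
    have wb: "w * b = of_real (norm b)"
      using b0 unfolding w_def
      by (simp add: field_simps complex_norm_square[symmetric] power2_eq_square[symmetric])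
    have ww: "w * cnj w = 1"
      using b0 unfolding w_def
      by (simp add: field_simps complex_norm_square[symmetric] power2_eq_square[symmetric])
    have wb': "cnj w * cnj b = of_real (norm b)"
      using arg_cong[OF wb, of cnj] by simp
    have bc: "sq A (U $ i) (U $ j) = cnj b" using sq_cnj[OF A] by (simp add: b_def)
    define p where "p = Re (sq A (U $ i) (U $ i))"
    define q where "q = Re (sq A (U $ j) (U $ j))"
    have pp: "sq A (U $ i) (U $ i) = of_real p"
      using sq_cnj[OF A, of "U $ i" "U $ i"] by (simp add: p_def complex_eq_iff)
    have qq: "sq A (U $ j) (U $ j) = of_real q"
      using sq_cnj[OF A, of "U $ j" "U $ j"] by (simp add: q_def complex_eq_iff)
    \<comment> \<open>\<open>\<tau>\<close> is the tangent of the rotation angle. Up to a positive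
      factor the gain in F is \<open>2 * norm b\<close> and the loss at most
      \<open>\<tau> * \<bar>q - p\<bar>\<close>; this choice keeps the loss at most
      \<open>norm b\<close>.\<close>
    define \<tau> where "\<tau> = norm b / (1 + \<bar>q - p\<bar>)"
    have \<tau>: "\<tau> > 0" using b0 by (simp add: \<tau>_def add_pos_nonneg)
    define C where "C = 1 / sqrt (1 + \<tau>\<^sup>2)"
    define S where "S = \<tau> * C"
    have C0: "C > 0" by (simp add: C_def add_pos_nonneg)
    have CC: "C * C + S * S = 1"
    proof -
      have "C * C + S * S = C\<^sup>2 * (1 + \<tau>\<^sup>2)" by (simp add: S_def power2_eq_square algebra_simps)
      also have "C\<^sup>2 = 1 / (1 + \<tau>\<^sup>2)" by (simp add: C_def power_divide add_nonneg_nonneg)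
      finally show ?thesis by (simp add: add_pos_nonneg pos_add_strict less_imp_neq[symmetric])
    qed
    have CC': "complex_of_real C * of_real C + of_real S * of_real S = 1"
      using CC by (metis of_real_1 of_real_add of_real_mult)
    define V where "V = (\<chi> k. if k = i then of_real C *s U $ i + (of_real S * w) *s U $ j
        else if k = j then (- of_real S * cnj w) *s U $ i + of_real C *s U $ j else U $ k)"
    have ij': "i \<noteq> j" using ij by auto
    have Vi: "V $ i = of_real C *s U $ i + (of_real S * w) *s U $ j" by (simp add: V_def)
    have Vj: "V $ j = (- of_real S * cnj w) *s U $ i + of_real C *s U $ j"
      using ij' by (simp add: V_def)
    have Vk: "V $ k = U $ k" if "k \<noteq> i" "k \<noteq> j" for k using that by (simp add: V_def)
    have on: "sq (mat 1) (U $ k) (U $ l) = (if k = l then 1 else 0)" for k l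
      using U unfolding unitary_iff_sq by blast
    have wwm: "w * (cnj w * z) = z" for z using ww by (metis mult.assoc mult_1)
    have "unitary V"
      unfolding unitary_iff_sq
    proof (intro allI)
      fix k l
      consider "k = i" | "k = j" | "k \<noteq> i \<and> k \<noteq> j \<and> i \<noteq> k \<and> j \<noteq> k" by blast
      then show "sq (mat 1) (V $ k) (V $ l) = (if k = l then 1 else 0)"
      proof cases
        case 1
        consider "l = i" | "l = j" | "l \<noteq> i \<and> l \<noteq> j \<and> i \<noteq> l \<and> j \<noteq> l" by blast
        then show ?thesis using 1 CC' ij' ij'[symmetric]
          by cases (simp_all add: Vi Vj Vk on ww wwm algebra_simps)
      next
        case 2
        consider "l = i" | "l = j" | "l \<noteq> i \<and> l \<noteq> j \<and> i \<noteq> l \<and> j \<noteq> l" by blast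
        then show ?thesis using 2 CC' ij' ij'[symmetric]
          by cases (simp_all add: Vi Vj Vk on ww wwm algebra_simps)
      next
        case 3
        consider "l = i" | "l = j" | "l \<noteq> i \<and> l \<noteq> j \<and> i \<noteq> l \<and> j \<noteq> l" by blast
        then show ?thesis using 3 ij' ij'[symmetric]
          by cases (simp_all add: Vi Vj Vk on ww wwm algebra_simps)
      qed
    qed
    then have le: "F V \<le> F U" by (rule max)
    have wbm: "b * (w * z) = of_real (norm b) * z" "cnj b * (cnj w * z) = of_real (norm b) * z" for z
      using wb wb' by (metis mult.assoc mult.commute)+
    have Bi: "sq A (V $ i) (V $ i) = of_real (C * C * p + S * S * q + 2 * (C * S * norm b))"
      unfolding Vi
      by (simp add: ww wb wb' wwm wbm pp qq bc b_def[symmetric] algebra_simps)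
    have Bj: "sq A (V $ j) (V $ j) = of_real (S * S * p + C * C * q - 2 * (C * S * norm b))"
      unfolding Vj
      by (simp add: ww wb wb' wwm wbm pp qq bc b_def[symmetric] algebra_simps)
    define f where "f W k = real (c k) * Re (sq A (W $ k) (W $ k))" for W :: "'n cmat" and k
    have split: "F W = f W i + f W j + (\<Sum>k\<in>UNIV - {i, j}. f W k)" for W
    proof -
      have "(\<Sum>k\<in>UNIV. f W k) = (\<Sum>k\<in>{i, j}. f W k) + (\<Sum>k\<in>UNIV - {i, j}. f W k)"
        by (subst sum.subset_diff[of "{i, j}"]) (auto simp: add.commute)
      then show ?thesis using ij' by (simp add: F_def f_def)
    qed
    have rest: "(\<Sum>k\<in>UNIV - {i, j}. f V k) = (\<Sum>k\<in>UNIV - {i, j}. f U k)"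
      by (intro sum.cong refl) (auto simp: f_def Vk)
    have "F V - F U = f V i + f V j - f U i - f U j"
      unfolding split rest by simp
    also have "\<dots> = real (c i) * (C * C * p + S * S * q + 2 * (C * S * norm b))
        + real (c j) * (S * S * p + C * C * q - 2 * (C * S * norm b)) - real (c i) * p - real (c j) * q"
      by (simp only: f_def Bi Bj pp qq Re_complex_of_real)
    also have "\<dots> = (real (c i) - real (c j)) * (S * S * (q - p) + 2 * (C * S * norm b))"
    proof -
      have e: "C * C = 1 - S * S" using CC by simp
      show ?thesis unfolding e by (simp add: algebra_simps)
    qed
    also have "S * S * (q - p) + 2 * (C * S * norm b) = C * C * \<tau> * (\<tau> * (q - p) + 2 * norm b)"
      by (simp add: S_def algebra_simps)
    finally have eq: "F V - F U = (real (c i) - real (c j)) * (C * C * \<tau> * (\<tau> * (q - p) + 2 * norm b))" .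
    have "\<tau> * \<bar>q - p\<bar> \<le> \<tau> * (1 + \<bar>q - p\<bar>)" using \<tau> by (intro mult_left_mono) auto
    also have "\<dots> = norm b" by (simp add: \<tau>_def)
    finally have "\<bar>\<tau> * (q - p)\<bar> \<le> norm b" using \<tau> by (simp add: abs_mult)
    then have "\<tau> * (q - p) + 2 * norm b > 0" using b0 by linarith
    then have "F V - F U > 0" unfolding eq using ij C0 \<tau> by simp
    with le show False by simp
  qed
  show thesis
  proof
    show "unitary U" by (rule U)
    fix i j :: 'n assume "i \<noteq> j"
    then have "c i \<noteq> c j" using c by (auto dest: injD)
    then consider "c i < c j" | "c j < c i" by linarith
    then show "sq A (U $ i) (U $ j) = 0"
    proof cases
      case 1 then show ?thesis by (rule off)
    next
      case 2
      then have "sq A (U $ j) (U $ i) = 0" by (rule off)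
      then show ?thesis using sq_cnj[OF A, of "U $ j" "U $ i"] by simp
    qed
  qed
qed

lemma spectral_theorem:
  fixes A :: "'n::finite cmat"
  assumes A: "self_adjoint A"
  obtains U l where "unitary U" "A = U ** dg l ** adj U"
proof -
  obtain V where V: "unitary V" and off: "\<And>i j. i \<noteq> j \<Longrightarrow> sq A (V $ i) (V $ j) = 0"
    using spectral_theorem_rows[OF A] by blast
  define l where "l i = Re (sq A (V $ i) (V $ i))" for i
  have "V ** A ** adj V = dg l"
    unfolding vec_eq_iff sandwich_nth
  proof (intro allI)
    fix i j
    show "sq A (V $ i) (V $ j) = dg l $ i $ j"
      using off[of i j] sq_cnj[OF A, of "V $ i" "V $ i"]
      by (auto simp: dg_def l_def complex_eq_iff)
  qed
  then have "adj V ** (V ** A ** adj V) ** V = adj V ** dg l ** V" by simp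
  then have "(adj V ** V) ** A ** (adj V ** V) = adj V ** dg l ** V"
    by (simp only: matrix_mul_assoc)
  then have "A = adj V ** dg l ** adj (adj V)" using unitaryD(2)[OF V] by simp
  then show thesis using that unitary_adj[OF V] by blast
qed

section \<open>Functional calculus and positivity\<close>

text \<open>\<open>W = adj V ** U\<close> intertwines the two diagonal matrices, so its entry (i, j)
  vanishes unless \<open>l j = m i\<close>; hence it also intertwines the diagonals after f is
  applied. This makes the functional calculus independent of the chosen diagonalisation.\<close>

lemma spectral_unique:
  fixes U V :: "'n::finite cmat"
  assumes U: "unitary U" and V: "unitary V" and eq: "U ** dg l ** adj U = V ** dg m ** adj V"
  shows "U ** dg (\<lambda>i. f (l i)) ** adj U = V ** dg (\<lambda>i. f (m i)) ** adj V"
proof -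
  define W where "W = adj V ** U"
  have "adj V ** (U ** dg l ** adj U) ** U = adj V ** (V ** dg m ** adj V) ** U" by (simp add: eq)
  then have "W ** dg l ** (adj U ** U) = (adj V ** V) ** dg m ** W"
    by (simp only: W_def matrix_mul_assoc)
  then have "W ** dg l = dg m ** W" using unitaryD(2)[OF U] unitaryD(2)[OF V] by simp
  then have "W $ i $ j * of_real (l j) = of_real (m i) * W $ i $ j" for i j
    by (metis dg_mult_left dg_mult_right)
  then have W: "W $ i $ j = 0 \<or> l j = m i" for i j
    by (simp add: mult.commute[of "W $ i $ j"])
  have "W $ i $ j * of_real (f (l j)) = of_real (f (m i)) * W $ i $ j" for i j
    using W[of i j] by auto
  then have "W ** dg (\<lambda>i. f (l i)) = dg (\<lambda>i. f (m i)) ** W"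
    by (simp add: vec_eq_iff dg_mult_left dg_mult_right)
  then have "V ** (W ** dg (\<lambda>i. f (l i))) ** adj U = V ** (dg (\<lambda>i. f (m i)) ** W) ** adj U" by simp
  then have "(V ** adj V) ** U ** dg (\<lambda>i. f (l i)) ** adj U
      = V ** dg (\<lambda>i. f (m i)) ** adj V ** (U ** adj U)"
    by (simp only: W_def matrix_mul_assoc)
  then show ?thesis using unitaryD(1)[OF U] unitaryD(1)[OF V] by simp
qed

text \<open>The diagonalisation is not unique, but by \<open>spectral_unique\<close> the result is.
  Only self-adjoint matrices have a decomposition of this form; elsewhere the value is
  arbitrary.\<close>

definition mfun :: "(real \<Rightarrow> real) \<Rightarrow> 'n::finite cmat \<Rightarrow> 'n cmat" where
  "mfun f A = (SOME B. \<exists>U l. unitary U \<and> A = U ** dg l ** adj U \<and>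
                 B = U ** dg (\<lambda>i. f (l i)) ** adj U)"

lemma mfun_eq:
  assumes "unitary U"
  shows "mfun f (U ** dg l ** adj U) = U ** dg (\<lambda>i. f (l i)) ** adj U"
  unfolding mfun_def
proof (rule some_equality)
  fix B assume "\<exists>V m. unitary V \<and> U ** dg l ** adj U = V ** dg m ** adj V \<and>
      B = V ** dg (\<lambda>i. f (m i)) ** adj V"
  then show "B = U ** dg (\<lambda>i. f (l i)) ** adj U"
    using spectral_unique[OF assms] by metis
qed (use assms in blast)

lemma self_adjoint_dg: "self_adjoint (U ** dg l ** adj U)"
  by (simp add: self_adjoint_def adj_mult matrix_mul_assoc)

lemma self_adjoint_mfun: "self_adjoint A \<Longrightarrow> self_adjoint (mfun f A)"
  by (erule spectral_theorem) (simp add: mfun_eq self_adjoint_dg)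

lemma mfun_mfun: "self_adjoint A \<Longrightarrow> mfun f (mfun g A) = mfun (\<lambda>x. f (g x)) A"
  by (erule spectral_theorem) (simp add: mfun_eq)

lemma mfun_id: "self_adjoint A \<Longrightarrow> mfun (\<lambda>x. x) A = A"
  by (erule spectral_theorem) (simp add: mfun_eq)

lemma mfun_ln_exp: "self_adjoint A \<Longrightarrow> mfun ln (mfun exp A) = A"
  by (simp add: mfun_mfun mfun_id)

lemma dg_arith:
  "dg l + dg m = dg (\<lambda>i. l i + m i)" "dg l - dg m = dg (\<lambda>i. l i - m i)"
  "r *\<^sub>R dg l = dg (\<lambda>i. r * l i)" "mat 1 = dg (\<lambda>i. 1)"
  by (simp_all add: vec_eq_iff dg_def mat_def complex_eq_iff)

lemma unitary_cancel:
  "unitary U \<Longrightarrow> X ** adj U ** U = X" "unitary U \<Longrightarrow> X ** U ** adj U = X"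
  by (metis matrix_mul_assoc matrix_mul_rid unitaryD)+

lemma spectral_arith:
  fixes U :: "'n::finite cmat"
  assumes "unitary U"
  shows "U ** dg l ** adj U + U ** dg m ** adj U = U ** dg (\<lambda>i. l i + m i) ** adj U"
    "U ** dg l ** adj U - U ** dg m ** adj U = U ** dg (\<lambda>i. l i - m i) ** adj U"
    "r *\<^sub>R (U ** dg l ** adj U) = U ** dg (\<lambda>i. r * l i) ** adj U"
    "mat 1 = U ** dg (\<lambda>i. 1) ** adj U"
    "(U ** dg l ** adj U) ** (U ** dg m ** adj U) = U ** dg (\<lambda>i. l i * m i) ** adj U"
proof -
  have "U ** dg l ** (adj U ** U) ** dg m ** adj U = U ** (dg l ** dg m) ** adj U"
    by (simp add: unitaryD[OF assms] matrix_mul_assoc)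
  then show "(U ** dg l ** adj U) ** (U ** dg m ** adj U) = U ** dg (\<lambda>i. l i * m i) ** adj U"
    by (simp add: matrix_mul_assoc dg_mult)
  show "mat 1 = U ** dg (\<lambda>i. 1) ** adj U"
    by (simp add: dg_arith[symmetric] unitaryD[OF assms])
qed (simp_all add: dg_arith[symmetric] matrix_linear_simps)

section \<open>Trace, and its expansion in two eigenbases\<close>

definition tr :: "'n::finite cmat \<Rightarrow> real" where
  "tr A = Re (trace A)"

lemma tr_linear:
  "tr (A + B) = tr A + tr B" "tr (A - B) = tr A - tr B" "tr (r *\<^sub>R A) = r * tr A" "tr 0 = 0"
  by (simp_all add: tr_def trace_def sum.distrib sum_subtractf sum_distrib_left)

lemma tr_commute: "tr (A ** B) = tr (B ** A)"
  unfolding tr_def by (subst trace_mul_sym) (rule refl)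

lemma tr_unitary: "unitary U \<Longrightarrow> tr (U ** X ** adj U) = tr X"
  by (metis matrix_mul_assoc matrix_mul_lid tr_commute unitaryD(2))

lemma tr_dg: "tr (dg l) = (\<Sum>i\<in>UNIV. l i)"
  by (simp add: tr_def trace_def dg_def)

lemma tr_dg_mult: "tr (dg l ** B) = (\<Sum>i\<in>UNIV. l i * Re (B $ i $ i))"
  by (simp add: tr_def trace_def dg_mult_left)

lemma tr_adj_mult: "tr (adj A ** B) = (\<Sum>i\<in>UNIV. \<Sum>j\<in>UNIV. Re (cnj (A $ j $ i) * B $ j $ i))"
  by (simp add: tr_def trace_def matrix_mult_nth)

lemma Re_cnj_mult: "Re (cnj z * (z * of_real r)) = (norm z)\<^sup>2 * r" "Re (cnj z * (of_real r * z)) = (norm z)\<^sup>2 * r"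
  unfolding cmod_power2 by (simp_all add: power2_eq_square algebra_simps)

text \<open>The weights are the squared moduli of the entries of the unitary matrix passing between
  the eigenbases. They form a doubly stochastic matrix, so trace inequalities for non-commuting
  matrices reduce to scalar inequalities for each pair of eigenvalues.\<close>

lemma tr_spectral_mult:
  assumes U: "unitary U" and V: "unitary V"
  shows "tr ((U ** dg p ** adj U) ** (V ** dg a ** adj V))
    = (\<Sum>i\<in>UNIV. \<Sum>j\<in>UNIV. (norm ((adj V ** U) $ j $ i))\<^sup>2 * (p i * a j))"
proof -
  have "tr ((U ** dg p ** adj U) ** (V ** dg a ** adj V))
      = tr (U ** (dg p ** (adj (adj V ** U) ** (dg a ** (adj V ** U)))) ** adj U)"
    by (simp add: matrix_mul_assoc adj_mult unitary_cancel[OF U])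
  also have "\<dots> = (\<Sum>i\<in>UNIV. p i * Re ((adj (adj V ** U) ** (dg a ** (adj V ** U))) $ i $ i))"
    by (simp add: tr_unitary[OF U] tr_dg_mult)
  also have "\<dots> = (\<Sum>i\<in>UNIV. p i * (\<Sum>j\<in>UNIV. (norm ((adj V ** U) $ j $ i))\<^sup>2 * a j))"
    by (simp only: matrix_mult_nth[of "adj (adj V ** U)"] dg_mult_left adj_nth Re_sum Re_cnj_mult)
  also have "\<dots> = (\<Sum>i\<in>UNIV. \<Sum>j\<in>UNIV. (norm ((adj V ** U) $ j $ i))\<^sup>2 * (p i * a j))"
    by (simp add: sum_distrib_left mult_ac)
  finally show ?thesis .
qed

lemma unitary_col_sum:
  assumes "unitary C" shows "(\<Sum>j\<in>UNIV. (norm (C $ j $ i))\<^sup>2) = 1"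
proof -
  have "complex_of_real (\<Sum>j\<in>UNIV. (norm (C $ j $ i))\<^sup>2) = (adj C ** C) $ i $ i"
    by (simp add: matrix_mult_nth complex_norm_square[symmetric] mult.commute[of "cnj _"]
        del: of_real_power)
  also have "\<dots> = of_real 1" using unitaryD(2)[OF assms] by (simp add: mat_def)
  finally show ?thesis by (simp only: of_real_eq_iff)
qed

lemma unitary_row_sum:
  assumes "unitary C" shows "(\<Sum>j\<in>UNIV. (norm (C $ i $ j))\<^sup>2) = 1"
  using unitary_col_sum[OF unitary_adj[OF assms], of i] by simp

section \<open>Quadratic forms and the positive semidefinite order\<close>

lemma inner_complex_Re: "x \<bullet> y = Re (cnj x * y)" for x y :: complex
  by (simp add: inner_complex_def)

lemma inner_adj: "x \<bullet> (adj B *v y) = (B *v x) \<bullet> y"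
proof -
  have "x \<bullet> (adj B *v y) = (\<Sum>i\<in>UNIV. \<Sum>k\<in>UNIV. Re (cnj (x $ i) * (cnj (B $ k $ i) * y $ k)))"
    by (simp only: inner_vec_def matrix_vector_mult_def inner_complex_Re vec_lambda_beta adj_nth
        sum_distrib_left Re_sum)
  also have "\<dots> = (\<Sum>k\<in>UNIV. \<Sum>i\<in>UNIV. Re (cnj (B $ k $ i * x $ i) * y $ k))"
    by (subst sum.swap) (simp only: complex_cnj_mult mult_ac)
  also have "\<dots> = (B *v x) \<bullet> y"
    by (simp only: inner_vec_def matrix_vector_mult_def inner_complex_Re vec_lambda_beta cnj_sum
        sum_distrib_right Re_sum)
  finally show ?thesis .
qed

lemma scaleR_matrix_vector: "(r *\<^sub>R A) *v x = r *\<^sub>R (A *v x)" for A :: "'n::finite cmat"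
  by (simp add: vec_eq_iff matrix_vector_mult_def scaleR_right.sum)

text \<open>The inner product is that of the underlying real Euclidean space, so this is the real
  part of the complex form and depends only on the Hermitian part of A.\<close>

definition qf :: "'n::finite cmat \<Rightarrow> complex ^ 'n \<Rightarrow> real" where
  "qf A x = x \<bullet> (A *v x)"

lemma qf_linear:
  "qf (A + B) x = qf A x + qf B x" "qf (A - B) x = qf A x - qf B x" "qf (r *\<^sub>R A) x = r * qf A x"
  "qf (mat 1) x = (norm x)\<^sup>2"
  by (simp_all add: qf_def matrix_vector_mult_add_rdistrib matrix_vector_mult_diff_rdistrib
      inner_add_right inner_diff_right scaleR_matrix_vector power2_norm_eq_inner)

lemma qf_sandwich: "qf (adj B ** A ** B) x = qf A (B *v x)"
  by (simp add: qf_def inner_adj matrix_vector_mul_assoc[symmetric])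

lemma qf_dg: "qf (dg l) x = (\<Sum>i\<in>UNIV. l i * (norm (x $ i))\<^sup>2)"
  by (simp add: qf_def inner_vec_def dg_def matrix_vector_mult_def
      if_distrib[of "\<lambda>x. x * _"] power2_norm_eq_inner scaleR_conv_of_real[symmetric] cong: if_cong)

lemma qf_spectral: "qf (U ** dg l ** adj U) x = (\<Sum>i\<in>UNIV. l i * (norm ((adj U *v x) $ i))\<^sup>2)"
  using qf_sandwich[of "adj U" "dg l" x] by (simp add: qf_dg)

lemma Re_sandwich_diag: "Re ((adj K ** A ** K) $ i $ i) = qf A (column i K)"
  unfolding matrix_mul_assoc[symmetric] qf_def inner_vec_def matrix_vector_mult_def inner_complex_Re
  by (simp only: matrix_mult_nth[of "adj K"] adj_nth Re_sum column_def vec_lambda_beta matrix_mult_nth)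

definition psd :: "'n::finite cmat \<Rightarrow> bool" where
  "psd A \<longleftrightarrow> self_adjoint A \<and> (\<forall>x. 0 \<le> qf A x)"

definition pd :: "'n::finite cmat \<Rightarrow> bool" where
  "pd A \<longleftrightarrow> self_adjoint A \<and> (\<forall>x. x \<noteq> 0 \<longrightarrow> 0 < qf A x)"

lemma qf_zero [simp]: "qf A 0 = 0"
  by (simp add: qf_def)

lemma pd_imp_psd: "pd A \<Longrightarrow> psd A"
  unfolding pd_def psd_def by (metis less_eq_real_def qf_zero)

lemma psd_spectral: "(\<And>i. 0 \<le> l i) \<Longrightarrow> psd (U ** dg l ** adj U)"
  by (simp add: psd_def self_adjoint_dg qf_spectral sum_nonneg)

lemma pd_spectral:
  assumes U: "unitary U" and l: "\<And>i. 0 < l i"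
  shows "pd (U ** dg l ** adj U)"
  unfolding pd_def
proof (intro conjI allI impI self_adjoint_dg)
  fix x :: "complex ^ 'a" assume "x \<noteq> 0"
  have "U *v (adj U *v x) = x" by (simp add: matrix_vector_mul_assoc unitaryD[OF U])
  then have "adj U *v x \<noteq> 0" using \<open>x \<noteq> 0\<close> by auto
  then obtain i where "(adj U *v x) $ i \<noteq> 0" by (auto simp: vec_eq_iff)
  then have "0 < l i * (norm ((adj U *v x) $ i))\<^sup>2" using l by simp
  also have "\<dots> \<le> (\<Sum>i\<in>UNIV. l i * (norm ((adj U *v x) $ i))\<^sup>2)"
    by (rule member_le_sum) (auto intro!: mult_nonneg_nonneg less_imp_le[OF l])
  finally show "0 < qf (U ** dg l ** adj U) x" by (simp add: qf_spectral)
qed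

lemma eigenvalue_qf:
  assumes U: "unitary U"
  shows "l i = qf (U ** dg l ** adj U) (column i U)"
  unfolding Re_sandwich_diag[symmetric]
  by (simp add: matrix_mul_assoc unitary_cancel[OF U] unitaryD[OF U]) (simp add: dg_def)

lemma unitary_column_nz: assumes "unitary U" shows "column i U \<noteq> 0"
proof
  assume "column i U = 0"
  then have "(adj U ** U) $ i $ i = 0" by (simp add: matrix_mult_nth column_def vec_eq_iff)
  then show False by (simp add: unitaryD[OF assms] mat_def)
qed

lemma psd_obtain:
  assumes "psd A"
  obtains U l where "unitary U" "A = U ** dg l ** adj U" "\<And>i. 0 \<le> l i"
  by (metis assms eigenvalue_qf psd_def spectral_theorem)

lemma pd_obtain:
  assumes "pd A"
  obtains U l where "unitary U" "A = U ** dg l ** adj U" "\<And>i. 0 < l i"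
  by (metis assms eigenvalue_qf pd_def spectral_theorem unitary_column_nz)

lemma tr_psd_sandwich_nonneg: "psd A \<Longrightarrow> 0 \<le> tr (adj K ** A ** K)"
  by (simp add: tr_def trace_def Re_sandwich_diag psd_def sum_nonneg)

lemma tr_psd_mult_nonneg:
  assumes "psd S" "psd B" shows "0 \<le> tr (S ** B)"
proof -
  obtain U p where U: "unitary U" and S: "S = U ** dg p ** adj U" and p: "\<And>i. 0 \<le> p i"
    using psd_obtain[OF \<open>psd S\<close>] by blast
  have "tr (S ** B) = tr (U ** (dg p ** (adj U ** B ** U)) ** adj U)"
    by (simp add: S matrix_mul_assoc unitary_cancel[OF U])
  also have "\<dots> = (\<Sum>i\<in>UNIV. p i * qf B (column i U))"
    by (simp add: tr_unitary[OF U] tr_dg_mult Re_sandwich_diag)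
  finally show ?thesis using p \<open>psd B\<close> by (simp add: psd_def sum_nonneg)
qed

section \<open>Relative entropy and Lieb's theorem\<close>

definition texp :: "'n::finite cmat \<Rightarrow> real" where
  "texp A = tr (mfun exp A)"

lemma texp_spectral: "unitary U \<Longrightarrow> texp (U ** dg l ** adj U) = (\<Sum>i\<in>UNIV. exp (l i))"
  by (simp add: texp_def mfun_eq tr_unitary tr_dg)

lemma pd_mfun_exp: "self_adjoint A \<Longrightarrow> pd (mfun exp A)"
  by (erule spectral_theorem) (simp add: mfun_eq pd_spectral)

text \<open>Expanding in the eigenbases of S and K leaves
  \<open>p * k - p * ln p + p \<le> exp k\<close> for each pair of eigenvalues, the Fenchel
  inequality for exp; it is \<open>ln x \<le> x - 1\<close> at \<open>x = exp k / p\<close>.\<close>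

lemma gibbs_variational:
  assumes S: "pd S" and K: "self_adjoint K"
  shows "tr (S ** K) - tr (S ** mfun ln S) + tr S \<le> texp K"
proof -
  obtain U p where U: "unitary U" and Seq: "S = U ** dg p ** adj U" and p: "\<And>i. 0 < p i"
    using pd_obtain[OF S] by blast
  obtain V k where V: "unitary V" and Keq: "K = V ** dg k ** adj V"
    using spectral_theorem[OF K] by blast
  define w where "w i j = (norm ((adj V ** U) $ j $ i))\<^sup>2" for i j
  have C: "unitary (adj V ** U)" by (intro unitary_mult unitary_adj U V)
  have w0: "w i j \<ge> 0" and w1: "(\<Sum>j\<in>UNIV. w i j) = 1" and w2: "(\<Sum>i\<in>UNIV. w i j) = 1" for i j
    using unitary_col_sum[OF C] unitary_row_sum[OF C] by (auto simp: w_def)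
  have a: "tr (S ** K) = (\<Sum>i\<in>UNIV. \<Sum>j\<in>UNIV. w i j * (p i * k j))"
    unfolding Seq Keq tr_spectral_mult[OF U V] w_def ..
  have b: "tr (S ** mfun ln S) = (\<Sum>i\<in>UNIV. \<Sum>j\<in>UNIV. w i j * (p i * ln (p i)))"
    by (simp add: Seq mfun_eq[OF U] spectral_arith[OF U] tr_unitary[OF U] tr_dg
        sum_distrib_right[symmetric] w1)
  have c: "tr S = (\<Sum>i\<in>UNIV. \<Sum>j\<in>UNIV. w i j * p i)"
    by (simp add: Seq tr_unitary[OF U] tr_dg sum_distrib_right[symmetric] w1)
  have d: "texp K = (\<Sum>i\<in>UNIV. \<Sum>j\<in>UNIV. w i j * exp (k j))"
    by (subst sum.swap) (simp add: Keq texp_spectral[OF V] sum_distrib_right[symmetric] w2)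
  have "w i j * (p i * k j) - w i j * (p i * ln (p i)) + w i j * p i \<le> w i j * exp (k j)" for i j
  proof -
    have "ln (exp (k j) / p i) \<le> exp (k j) / p i - 1"
      by (rule ln_le_minus_one) (use p in simp)
    then have "k j - ln (p i) \<le> exp (k j) / p i - 1" using p[of i] by (simp add: ln_div)
    then have "p i * (k j - ln (p i)) \<le> p i * (exp (k j) / p i - 1)"
      using p[of i] by (intro mult_left_mono) auto
    then have "p i * k j - p i * ln (p i) + p i \<le> exp (k j)" using p[of i] by (simp add: algebra_simps)
    then have "w i j * (p i * k j - p i * ln (p i) + p i) \<le> w i j * exp (k j)"
      by (rule mult_left_mono) (rule w0)
    then show ?thesis by (simp add: algebra_simps)
  qed
  then have "(\<Sum>i\<in>UNIV. \<Sum>j\<in>UNIV. w i j * (p i * k j) - w i j * (p i * ln (p i)) + w i j * p i)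
      \<le> (\<Sum>i\<in>UNIV. \<Sum>j\<in>UNIV. w i j * exp (k j))"
    by (intro sum_mono)
  then show ?thesis unfolding a b c d by (simp only: sum.distrib sum_subtractf)
qed

lemma gibbs_equality:
  assumes "self_adjoint K"
  shows "texp K = tr (mfun exp K ** K) - tr (mfun exp K ** mfun ln (mfun exp K)) + tr (mfun exp K)"
  by (simp add: mfun_ln_exp[OF assms] texp_def)

text \<open>The exponential is not operator monotone, but its trace is monotone: the maximiser S for
  A is also a competitor for B, and \<open>tr (S ** (B - A))\<close> is nonnegative.\<close>

lemma texp_mono:
  assumes "self_adjoint A" "self_adjoint B" "psd (B - A)"
  shows "texp A \<le> texp B"
proof -
  let ?S = "mfun exp A"
  have S: "pd ?S" by (rule pd_mfun_exp) fact
  have "0 \<le> tr (?S ** (B - A))" using pd_imp_psd[OF S] assms(3) by (rule tr_psd_mult_nonneg)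
  then show ?thesis using gibbs_equality[OF assms(1)] gibbs_variational[OF S assms(2)]
    by (simp add: matrix_linear_simps tr_linear)
qed

section \<open>Relative entropy: integral representation, joint convexity, monotonicity\<close>

definition rel_ent :: "'n::finite cmat \<Rightarrow> 'n cmat \<Rightarrow> real" where
  "rel_ent S A = tr (S ** mfun ln S) - tr (S ** mfun ln A)"

text \<open>With L and R for left and right multiplication and the real trace inner product, this is
  \<open>2 <K, S> - <K, ((1 - \<tau>) R_S + \<tau> L_A) K>\<close>. It is linear in (S, A) for fixed
  K, and for positive definite S, A and 0 < \<tau> \<le> 1 its maximum over K is
  \<open><S, ((1 - \<tau>) R_S + \<tau> L_A)^-1 S>\<close>.\<close>

definition ent_test :: "real \<Rightarrow> 'n::finite cmat \<Rightarrow> 'n cmat \<Rightarrow> 'n cmat \<Rightarrow> real" where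
  "ent_test \<tau> K S A = 2 * tr (adj K ** S) - (1 - \<tau>) * tr (K ** S ** adj K) - \<tau> * tr (adj K ** A ** K)"

text \<open>Left multiplication by A and right multiplication by S commute; writing K with the
  eigenbasis of A on the left and that of S on the right diagonalises both, so the entries of M
  decouple.\<close>

lemma ent_test_spectral:
  fixes U V M :: "'n::finite cmat"
  assumes U: "unitary U" and V: "unitary V"
  shows "ent_test \<tau> (V ** M ** adj U) (U ** dg p ** adj U) (V ** dg a ** adj V)
    = (\<Sum>i\<in>UNIV. \<Sum>j\<in>UNIV. 2 * p i * Re (cnj (M $ j $ i) * (adj V ** U) $ j $ i)
          - (norm (M $ j $ i))\<^sup>2 * ((1 - \<tau>) * p i + \<tau> * a j))"
proof -
  let ?C = "adj V ** U"
  let ?K = "V ** M ** adj U"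
  have "tr (adj ?K ** (U ** dg p ** adj U)) = tr (U ** (adj M ** (?C ** dg p)) ** adj U)"
    by (simp add: adj_mult matrix_mul_assoc)
  also have "\<dots> = (\<Sum>i\<in>UNIV. \<Sum>j\<in>UNIV. p i * Re (cnj (M $ j $ i) * ?C $ j $ i))"
    by (simp add: tr_unitary[OF U] tr_adj_mult dg_mult_right algebra_simps)
  finally have 1: "tr (adj ?K ** (U ** dg p ** adj U))
      = (\<Sum>i\<in>UNIV. \<Sum>j\<in>UNIV. p i * Re (cnj (M $ j $ i) * ?C $ j $ i))" .
  have "tr (?K ** (U ** dg p ** adj U) ** adj ?K) = tr (V ** ((M ** dg p) ** adj M) ** adj V)"
    by (simp add: adj_mult matrix_mul_assoc unitary_cancel[OF U])
  also have "\<dots> = tr (adj M ** (M ** dg p))"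
    by (simp add: tr_unitary[OF V] tr_commute[of "M ** dg p"])
  also have "\<dots> = (\<Sum>i\<in>UNIV. \<Sum>j\<in>UNIV. (norm (M $ j $ i))\<^sup>2 * p i)"
    by (simp only: tr_adj_mult dg_mult_right Re_cnj_mult)
  finally have 2: "tr (?K ** (U ** dg p ** adj U) ** adj ?K)
      = (\<Sum>i\<in>UNIV. \<Sum>j\<in>UNIV. (norm (M $ j $ i))\<^sup>2 * p i)" .
  have "tr (adj ?K ** (V ** dg a ** adj V) ** ?K) = tr (U ** (adj M ** (dg a ** M)) ** adj U)"
    by (simp add: adj_mult matrix_mul_assoc unitary_cancel[OF V])
  also have "\<dots> = (\<Sum>i\<in>UNIV. \<Sum>j\<in>UNIV. (norm (M $ j $ i))\<^sup>2 * a j)"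
    by (simp only: tr_unitary[OF U] tr_adj_mult dg_mult_left Re_cnj_mult)
  finally have 3: "tr (adj ?K ** (V ** dg a ** adj V) ** ?K)
      = (\<Sum>i\<in>UNIV. \<Sum>j\<in>UNIV. (norm (M $ j $ i))\<^sup>2 * a j)" .
  show ?thesis unfolding ent_test_def 1 2 3
    by (simp only: sum_distrib_left sum_subtractf[symmetric])
       (intro sum.cong refl, simp add: algebra_simps)
qed

text \<open>Completing the square in m; the maximiser is m = (p / d) c, which the second part
  evaluates. In the entropy test d is \<open>(1 - \<tau>) * p + \<tau> * a\<close>.\<close>

lemma quadratic_max:
  fixes m c :: complex
  assumes "d > 0"
  shows "2 * p * Re (cnj m * c) - (norm m)\<^sup>2 * d \<le> (norm c)\<^sup>2 * (p\<^sup>2 / d)"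
    and "2 * p * Re (cnj (of_real (p / d) * c) * c) - (norm (of_real (p / d) * c))\<^sup>2 * d
          = (norm c)\<^sup>2 * (p\<^sup>2 / d)"
proof -
  have "0 \<le> (norm (of_real d * m - of_real p * c))\<^sup>2" by simp
  also have "\<dots> = d\<^sup>2 * (norm m)\<^sup>2 + p\<^sup>2 * (norm c)\<^sup>2 - d * (2 * p * Re (cnj m * c))"
    unfolding cmod_power2 by (simp add: power2_eq_square algebra_simps)
  finally have "d * (2 * p * Re (cnj m * c) - (norm m)\<^sup>2 * d) \<le> p\<^sup>2 * (norm c)\<^sup>2"
    by (simp add: power2_eq_square algebra_simps)
  then show "2 * p * Re (cnj m * c) - (norm m)\<^sup>2 * d \<le> (norm c)\<^sup>2 * (p\<^sup>2 / d)"
    using assms by (simp add: field_simps)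
  have "Re (cnj (of_real (p / d) * c) * c) = (p / d) * (norm c)\<^sup>2"
    unfolding cmod_power2 by (simp add: power2_eq_square algebra_simps add_divide_distrib)
  then show "2 * p * Re (cnj (of_real (p / d) * c) * c) - (norm (of_real (p / d) * c))\<^sup>2 * d
          = (norm c)\<^sup>2 * (p\<^sup>2 / d)"
    using assms by (simp add: norm_mult power_mult_distrib norm_divide power_divide power2_eq_square field_simps)
qed

text \<open>The denominator runs from p to a with derivative a - p in \<tau>, so - p times its
  logarithm is an antiderivative.\<close>

lemma ln_ratio_integral:
  fixes p a :: real
  assumes "p > 0" "a > 0"
  shows "((\<lambda>\<tau>. (p\<^sup>2 - a * p) / ((1 - \<tau>) * p + \<tau> * a)) has_integral p * ln p - p * ln a) {0..1}"
proof -
  have "((\<lambda>\<tau>. (p\<^sup>2 - a * p) / ((1 - \<tau>) * p + \<tau> * a)) has_integral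
      (- p * ln ((1 - 1) * p + 1 * a)) - (- p * ln ((1 - 0) * p + 0 * a))) {0..1}"
  proof (rule fundamental_theorem_of_calculus)
    fix x :: real assume x: "x \<in> {0..1}"
    have "(1 - x) * p + x * a > 0"
    proof (cases "x = 0")
      case False
      then have "x * a > 0" "(1 - x) * p \<ge> 0" using x assms by auto
      then show ?thesis by linarith
    qed (use assms in simp)
    then show "((\<lambda>\<tau>. - p * ln ((1 - \<tau>) * p + \<tau> * a)) has_vector_derivative
        (p\<^sup>2 - a * p) / ((1 - x) * p + x * a)) (at x within {0..1})"
      unfolding has_real_derivative_iff_has_vector_derivative[symmetric]
      by (auto intro!: derivative_eq_intros simp: field_simps power2_eq_square)
  qed simp
  then show ?thesis by simp
qed

text \<open>Summing \<open>ln_ratio_integral\<close> over pairs of eigenvalues gives the integrand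
  e. The identity \<open>\<tau> (p^2 - a p) + p d = p^2\<close> with
  \<open>d = (1 - \<tau>) p + \<tau> a\<close> identifies \<open>\<tau> * e \<tau> + tr S\<close> as
  the maximum of the test functional. This says nothing about e at 0, whose value is therefore given
  separately and is again linear in (S, A).\<close>

lemma rel_ent_integral:
  fixes S A :: "'n::finite cmat"
  assumes S: "pd S" and A: "pd A"
  obtains e where "(e has_integral rel_ent S A) {0..1}" "e 0 = tr S - tr A"
    "\<And>\<tau> K. 0 < \<tau> \<Longrightarrow> \<tau> \<le> 1 \<Longrightarrow> ent_test \<tau> K S A \<le> \<tau> * e \<tau> + tr S"
    "\<And>\<tau>. 0 < \<tau> \<Longrightarrow> \<tau> \<le> 1 \<Longrightarrow> \<exists>K. ent_test \<tau> K S A = \<tau> * e \<tau> + tr S"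
proof -
  obtain U p where U: "unitary U" and Seq: "S = U ** dg p ** adj U" and p: "\<And>i. 0 < p i"
    using pd_obtain[OF S] by blast
  obtain V a where V: "unitary V" and Aeq: "A = V ** dg a ** adj V" and a: "\<And>i. 0 < a i"
    using pd_obtain[OF A] by blast
  let ?C = "adj V ** U"
  define w where "w i j = (norm (?C $ j $ i))\<^sup>2" for i j
  have C: "unitary ?C" by (intro unitary_mult unitary_adj U V)
  have w1: "(\<Sum>j\<in>UNIV. w i j) = 1" and w2: "(\<Sum>i\<in>UNIV. w i j) = 1" for i j
    using unitary_col_sum[OF C] unitary_row_sum[OF C] by (auto simp: w_def)
  define den where "den \<tau> i j = (1 - \<tau>) * p i + \<tau> * a j" for \<tau> i j
  define e where "e \<tau> = (\<Sum>i\<in>UNIV. \<Sum>j\<in>UNIV. w i j * (((p i)\<^sup>2 - a j * p i) / den \<tau> i j))" for \<tau>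
  have den: "den \<tau> i j > 0" if "0 < \<tau>" "\<tau> \<le> 1" for \<tau> i j
    unfolding den_def using that p[of i] a[of j] by (intro add_nonneg_pos) auto
  have trS: "tr S = (\<Sum>i\<in>UNIV. \<Sum>j\<in>UNIV. w i j * p i)"
    by (simp add: Seq tr_unitary[OF U] tr_dg sum_distrib_right[symmetric] w1)
  have trA: "tr A = (\<Sum>i\<in>UNIV. \<Sum>j\<in>UNIV. w i j * a j)"
    by (subst sum.swap) (simp add: Aeq tr_unitary[OF V] tr_dg sum_distrib_right[symmetric] w2)
  have b: "tr (S ** mfun ln S) = (\<Sum>i\<in>UNIV. \<Sum>j\<in>UNIV. w i j * (p i * ln (p i)))"
    by (simp add: Seq mfun_eq[OF U] spectral_arith[OF U] tr_unitary[OF U] tr_dg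
        sum_distrib_right[symmetric] w1)
  have c: "tr (S ** mfun ln A) = (\<Sum>i\<in>UNIV. \<Sum>j\<in>UNIV. w i j * (p i * ln (a j)))"
    unfolding Seq Aeq mfun_eq[OF V] tr_spectral_mult[OF U V] w_def ..
  have ent: "rel_ent S A = (\<Sum>i\<in>UNIV. \<Sum>j\<in>UNIV. w i j * (p i * ln (p i) - p i * ln (a j)))"
    unfolding rel_ent_def b c by (simp only: sum_subtractf[symmetric] right_diff_distrib)
  show thesis
  proof
    show "(e has_integral rel_ent S A) {0..1}"
      unfolding ent e_def[abs_def] den_def
      by (intro has_integral_sum has_integral_mult_right ln_ratio_integral p a) auto
    have "w i j * (((p i)\<^sup>2 - a j * p i) / den 0 i j) = w i j * p i - w i j * a j" for i j
      using p[of i] by (simp add: den_def field_simps power2_eq_square)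
    then show "e 0 = tr S - tr A" by (simp add: e_def trS trA sum_subtractf)
  next
    fix \<tau> :: real assume \<tau>: "0 < \<tau>" "\<tau> \<le> 1"
    have "\<tau> * (w i j * (((p i)\<^sup>2 - a j * p i) / den \<tau> i j)) + w i j * p i
        = w i j * ((p i)\<^sup>2 / den \<tau> i j)" for i j
    proof -
      have "\<tau> * ((p i)\<^sup>2 - a j * p i) / den \<tau> i j + p i * den \<tau> i j / den \<tau> i j = (p i)\<^sup>2 / den \<tau> i j"
        unfolding add_divide_distrib[symmetric]
        by (simp add: den_def algebra_simps power2_eq_square)
      then have "\<tau> * ((p i)\<^sup>2 - a j * p i) / den \<tau> i j + p i = (p i)\<^sup>2 / den \<tau> i j"
        using den[OF \<tau>, of i j] by simp
      then have "w i j * (\<tau> * ((p i)\<^sup>2 - a j * p i) / den \<tau> i j + p i) = w i j * ((p i)\<^sup>2 / den \<tau> i j)"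
        by simp
      then show ?thesis by (simp add: algebra_simps)
    qed
    then have Q: "\<tau> * e \<tau> + tr S = (\<Sum>i\<in>UNIV. \<Sum>j\<in>UNIV. (norm (?C $ j $ i))\<^sup>2 * ((p i)\<^sup>2 / den \<tau> i j))"
      unfolding e_def trS by (simp only: sum_distrib_left sum.distrib[symmetric]) (simp only: w_def)
    show "ent_test \<tau> K S A \<le> \<tau> * e \<tau> + tr S" for K
    proof -
      define M where "M = adj V ** K ** U"
      have K: "K = V ** M ** adj U"
        by (simp add: M_def matrix_mul_assoc unitary_cancel[OF U] unitaryD[OF V])
      show ?thesis unfolding Q unfolding K Seq Aeq ent_test_spectral[OF U V] den_def[symmetric]
        by (intro sum_mono quadratic_max den \<tau>)
    qed
    \<comment> \<open>The entrywise maximisers of \<open>quadratic_max\<close>, assembled into one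
      matrix.\<close>
    define M where "M = (\<chi> j i. of_real (p i / den \<tau> i j) * ?C $ j $ i)"
    have M: "M $ j $ i = of_real (p i / den \<tau> i j) * ?C $ j $ i" for i j by (simp add: M_def)
    have "ent_test \<tau> (V ** M ** adj U) S A = \<tau> * e \<tau> + tr S"
      unfolding Q unfolding Seq Aeq ent_test_spectral[OF U V] den_def[symmetric] M
      by (intro sum.cong refl quadratic_max den \<tau>)
    then show "\<exists>K. ent_test \<tau> K S A = \<tau> * e \<tau> + tr S" by blast
  qed
qed

lemma pd_convex_comb:
  assumes "pd A" "pd B" "0 \<le> u" "0 \<le> v" "u + v = 1"
  shows "pd (u *\<^sub>R A + v *\<^sub>R B)"
  unfolding pd_def
proof (intro conjI allI impI)
  show "self_adjoint (u *\<^sub>R A + v *\<^sub>R B)"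
    using assms by (auto simp: pd_def intro!: self_adjoint_intros)
  fix x :: "complex ^ 'a" assume "x \<noteq> 0"
  then have q: "0 < qf A x" "0 < qf B x" using assms by (auto simp: pd_def)
  show "0 < qf (u *\<^sub>R A + v *\<^sub>R B) x"
  proof (cases "u = 0")
    case False
    then have "0 < u * qf A x" using q assms by simp
    moreover have "0 \<le> v * qf B x" using q assms by simp
    ultimately show ?thesis by (simp add: qf_linear)
  qed (use q assms in \<open>simp add: qf_linear\<close>)
qed

text \<open>For each \<tau> > 0 take K optimal for the mixed pair. The test functional splits
  linearly over the two pairs, each part is bounded by its own maximum, and the trace terms cancel;
  dividing by \<tau> and integrating gives the claim.\<close>

lemma rel_ent_jointly_convex:
  assumes S: "pd S1" "pd S2" and A: "pd A1" "pd A2" and uv: "0 \<le> u" "0 \<le> v" "u + v = 1"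
  shows "rel_ent (u *\<^sub>R S1 + v *\<^sub>R S2) (u *\<^sub>R A1 + v *\<^sub>R A2) \<le> u * rel_ent S1 A1 + v * rel_ent S2 A2"
proof -
  let ?S = "u *\<^sub>R S1 + v *\<^sub>R S2" and ?A = "u *\<^sub>R A1 + v *\<^sub>R A2"
  obtain e1 where e1: "(e1 has_integral rel_ent S1 A1) {0..1}" "e1 0 = tr S1 - tr A1"
    "\<And>\<tau> K. 0 < \<tau> \<Longrightarrow> \<tau> \<le> 1 \<Longrightarrow> ent_test \<tau> K S1 A1 \<le> \<tau> * e1 \<tau> + tr S1"
    "\<And>\<tau>. 0 < \<tau> \<Longrightarrow> \<tau> \<le> 1 \<Longrightarrow> \<exists>K. ent_test \<tau> K S1 A1 = \<tau> * e1 \<tau> + tr S1"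
    by (rule rel_ent_integral[OF S(1) A(1)]) (rule that)
  obtain e2 where e2: "(e2 has_integral rel_ent S2 A2) {0..1}" "e2 0 = tr S2 - tr A2"
    "\<And>\<tau> K. 0 < \<tau> \<Longrightarrow> \<tau> \<le> 1 \<Longrightarrow> ent_test \<tau> K S2 A2 \<le> \<tau> * e2 \<tau> + tr S2"
    "\<And>\<tau>. 0 < \<tau> \<Longrightarrow> \<tau> \<le> 1 \<Longrightarrow> \<exists>K. ent_test \<tau> K S2 A2 = \<tau> * e2 \<tau> + tr S2"
    by (rule rel_ent_integral[OF S(2) A(2)]) (rule that)
  obtain e where e: "(e has_integral rel_ent ?S ?A) {0..1}" "e 0 = tr ?S - tr ?A"
    "\<And>\<tau> K. 0 < \<tau> \<Longrightarrow> \<tau> \<le> 1 \<Longrightarrow> ent_test \<tau> K ?S ?A \<le> \<tau> * e \<tau> + tr ?S"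
    "\<And>\<tau>. 0 < \<tau> \<Longrightarrow> \<tau> \<le> 1 \<Longrightarrow> \<exists>K. ent_test \<tau> K ?S ?A = \<tau> * e \<tau> + tr ?S"
    by (rule rel_ent_integral[OF pd_convex_comb[OF S uv] pd_convex_comb[OF A uv]]) (rule that)
  show ?thesis
  proof (rule has_integral_le)
    show "(e has_integral rel_ent ?S ?A) {0..1}" by (rule e)
    show "((\<lambda>\<tau>. u * e1 \<tau> + v * e2 \<tau>) has_integral u * rel_ent S1 A1 + v * rel_ent S2 A2) {0..1}"
      by (intro has_integral_add has_integral_mult_right e1 e2)
    fix \<tau> :: real assume \<tau>: "\<tau> \<in> {0..1}"
    show "e \<tau> \<le> u * e1 \<tau> + v * e2 \<tau>"
    proof (cases "\<tau> = 0")
      case True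
      then show ?thesis by (simp add: e(2) e1(2) e2(2) tr_linear algebra_simps)
    next
      case False
      then have \<tau>: "0 < \<tau>" "\<tau> \<le> 1" using \<tau> by auto
      obtain K where "ent_test \<tau> K ?S ?A = \<tau> * e \<tau> + tr ?S" using e(4)[OF \<tau>] by blast
      moreover have "ent_test \<tau> K ?S ?A = u * ent_test \<tau> K S1 A1 + v * ent_test \<tau> K S2 A2"
        by (simp add: ent_test_def matrix_linear_simps tr_linear algebra_simps)
      moreover have "u * ent_test \<tau> K S1 A1 \<le> u * (\<tau> * e1 \<tau> + tr S1)"
        "v * ent_test \<tau> K S2 A2 \<le> v * (\<tau> * e2 \<tau> + tr S2)"
        by (intro mult_left_mono e1 e2 \<tau> uv)+
      ultimately have "\<tau> * e \<tau> \<le> \<tau> * (u * e1 \<tau> + v * e2 \<tau>)"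
        by (simp add: tr_linear algebra_simps)
      then show ?thesis using \<tau> by simp
    qed
  qed
qed

text \<open>The second argument enters the test functional only through
  \<open>- \<tau> * tr (adj K ** A ** K)\<close>, which is monotone. This replaces an appeal to
  operator monotonicity of the logarithm.\<close>

lemma rel_ent_antimono:
  assumes S: "pd S" and A: "pd A" "pd B" and AB: "psd (B - A)"
  shows "rel_ent S B \<le> rel_ent S A"
proof -
  obtain e1 where e1: "(e1 has_integral rel_ent S A) {0..1}" "e1 0 = tr S - tr A"
    "\<And>\<tau> K. 0 < \<tau> \<Longrightarrow> \<tau> \<le> 1 \<Longrightarrow> ent_test \<tau> K S A \<le> \<tau> * e1 \<tau> + tr S"
    "\<And>\<tau>. 0 < \<tau> \<Longrightarrow> \<tau> \<le> 1 \<Longrightarrow> \<exists>K. ent_test \<tau> K S A = \<tau> * e1 \<tau> + tr S"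
    by (rule rel_ent_integral[OF S A(1)]) (rule that)
  obtain e where e: "(e has_integral rel_ent S B) {0..1}" "e 0 = tr S - tr B"
    "\<And>\<tau> K. 0 < \<tau> \<Longrightarrow> \<tau> \<le> 1 \<Longrightarrow> ent_test \<tau> K S B \<le> \<tau> * e \<tau> + tr S"
    "\<And>\<tau>. 0 < \<tau> \<Longrightarrow> \<tau> \<le> 1 \<Longrightarrow> \<exists>K. ent_test \<tau> K S B = \<tau> * e \<tau> + tr S"
    by (rule rel_ent_integral[OF S A(2)]) (rule that)
  have sandwich: "tr (adj K ** A ** K) \<le> tr (adj K ** B ** K)" for K
    using tr_psd_sandwich_nonneg[OF AB, of K] by (simp add: matrix_linear_simps tr_linear)
  show ?thesis
  proof (rule has_integral_le)
    show "(e has_integral rel_ent S B) {0..1}" "(e1 has_integral rel_ent S A) {0..1}" by (rule e e1)+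
    fix \<tau> :: real assume \<tau>: "\<tau> \<in> {0..1}"
    show "e \<tau> \<le> e1 \<tau>"
    proof (cases "\<tau> = 0")
      case True
      then show ?thesis using sandwich[of "mat 1"] by (simp add: e(2) e1(2))
    next
      case False
      then have \<tau>: "0 < \<tau>" "\<tau> \<le> 1" using \<tau> by auto
      obtain K where "ent_test \<tau> K S B = \<tau> * e \<tau> + tr S" using e(4)[OF \<tau>] by blast
      moreover have "\<tau> * tr (adj K ** A ** K) \<le> \<tau> * tr (adj K ** B ** K)"
        using sandwich \<tau> by simp
      moreover have "ent_test \<tau> K S A \<le> \<tau> * e1 \<tau> + tr S" by (intro e1 \<tau>)
      ultimately have "\<tau> * e \<tau> \<le> \<tau> * e1 \<tau>" unfolding ent_test_def by linarith
      then show ?thesis using \<tau> by simp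
    qed
  qed
qed

section \<open>Lieb's concavity theorem and its monotone companion\<close>

lemma texp_add_ln:
  assumes K: "self_adjoint K" and A: "pd A" and S: "S = mfun exp (K + mfun ln A)"
  shows "texp (K + mfun ln A) = tr (S ** K) + tr S - rel_ent S A" "pd S"
proof -
  have "self_adjoint (K + mfun ln A)"
    using A K by (auto simp: pd_def intro: self_adjoint_intros self_adjoint_mfun)
  from gibbs_equality[OF this] pd_mfun_exp[OF this]
  show "texp (K + mfun ln A) = tr (S ** K) + tr S - rel_ent S A" "pd S"
    by (simp_all add: S rel_ent_def matrix_linear_simps tr_linear)
qed

lemma texp_add_ln_ge:
  assumes K: "self_adjoint K" and A: "pd A" and S: "pd S"
  shows "tr (S ** K) + tr S - rel_ent S A \<le> texp (K + mfun ln A)"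
proof -
  have "self_adjoint (K + mfun ln A)"
    using A K by (auto simp: pd_def intro: self_adjoint_intros self_adjoint_mfun)
  from gibbs_variational[OF S this] show ?thesis
    by (simp add: rel_ent_def matrix_linear_simps tr_linear)
qed

text \<open>Maximising a jointly concave function over one argument leaves it concave in the other:
  the mixture of the optimal matrices \<open>S1\<close> and \<open>S2\<close> is a competitor for
  the mixed argument.\<close>

theorem lieb_concavity:
  assumes K: "self_adjoint K" and A: "pd A1" "pd A2" and uv: "0 \<le> u" "0 \<le> v" "u + v = 1"
  shows "u * texp (K + mfun ln A1) + v * texp (K + mfun ln A2)
    \<le> texp (K + mfun ln (u *\<^sub>R A1 + v *\<^sub>R A2))"
proof -
  define S1 where "S1 = mfun exp (K + mfun ln A1)"
  define S2 where "S2 = mfun exp (K + mfun ln A2)"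
  let ?S = "u *\<^sub>R S1 + v *\<^sub>R S2" and ?A = "u *\<^sub>R A1 + v *\<^sub>R A2"
  note S1 = texp_add_ln[OF K A(1) S1_def] and S2 = texp_add_ln[OF K A(2) S2_def]
  have "tr (?S ** K) + tr ?S - rel_ent ?S ?A \<le> texp (K + mfun ln ?A)"
    by (intro texp_add_ln_ge K pd_convex_comb A S1 S2 uv)
  moreover have "rel_ent ?S ?A \<le> u * rel_ent S1 A1 + v * rel_ent S2 A2"
    by (intro rel_ent_jointly_convex S1 S2 A uv)
  ultimately show ?thesis unfolding S1 S2
    by (simp add: matrix_linear_simps tr_linear algebra_simps)
qed

text \<open>The S that is optimal for A remains admissible for B, and passing from A to B can only
  lower the relative entropy.\<close>

lemma texp_add_ln_mono:
  assumes K: "self_adjoint K" and A: "pd A" "pd B" and AB: "psd (B - A)"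
  shows "texp (K + mfun ln A) \<le> texp (K + mfun ln B)"
proof -
  define S where "S = mfun exp (K + mfun ln A)"
  note S = texp_add_ln[OF K A(1) S_def]
  show ?thesis using texp_add_ln_ge[OF K A(2) S(2)] rel_ent_antimono[OF S(2) A AB] S(1) by linarith
qed

section \<open>The one-step trace inequality\<close>

text \<open>A hyperplane separates the strict hypograph from the point (x0, f x0). It cannot be
  vertical because x0 is interior to S, so it can be solved for the last coordinate.\<close>

lemma concave_supergradient:
  fixes f :: "'a::euclidean_space \<Rightarrow> real"
  assumes conv: "convex S"
    and conc: "\<And>x y u v. x \<in> S \<Longrightarrow> y \<in> S \<Longrightarrow> 0 \<le> u \<Longrightarrow> 0 \<le> v \<Longrightarrow> u + v = 1 \<Longrightarrow>
        u * f x + v * f y \<le> f (u *\<^sub>R x + v *\<^sub>R y)"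
    and int: "x0 \<in> interior S"
  obtains a where "\<And>x. x \<in> S \<Longrightarrow> f x \<le> f x0 + a \<bullet> (x - x0)"
proof -
  have x0: "x0 \<in> S" using int interior_subset by blast
  define C where "C = {(x, r). x \<in> S \<and> r < f x}"
  have "convex C"
  proof (rule convexI)
    fix p q and u v :: real
    assume p: "p \<in> C" and q: "q \<in> C" and uv: "0 \<le> u" "0 \<le> v" "u + v = 1"
    obtain x r y s where pq: "p = (x, r)" "q = (y, s)" by (cases p, cases q)
    have xy: "x \<in> S" "y \<in> S" "r < f x" "s < f y" using p q by (auto simp: C_def pq)
    have "u * r + v * s < u * f x + v * f y"
    proof (cases "u = 0")
      case True then show ?thesis using uv xy by simp
    next
      case False
      then have "u * r < u * f x" "v * s \<le> v * f y" using uv xy by (auto intro: mult_left_mono)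
      then show ?thesis by linarith
    qed
    also have "\<dots> \<le> f (u *\<^sub>R x + v *\<^sub>R y)" by (rule conc[OF xy(1,2) uv])
    finally show "u *\<^sub>R p + v *\<^sub>R q \<in> C"
      using convexD[OF conv xy(1,2) uv] by (simp add: C_def pq)
  qed
  moreover have "(x0, f x0 - 1) \<in> C" using x0 by (simp add: C_def)
  then have "C \<noteq> {}" by blast
  moreover have "C \<inter> {(x0, f x0)} = {}" by (auto simp: C_def)
  ultimately have "\<exists>a b. a \<noteq> 0 \<and> (\<forall>p\<in>C. a \<bullet> p \<le> b) \<and> (\<forall>p\<in>{(x0, f x0)}. a \<bullet> p \<ge> b)"
    by (intro separating_hyperplane_sets) simp_all
  then obtain a b where a0: "a \<noteq> 0" and le: "\<And>p. p \<in> C \<Longrightarrow> a \<bullet> p \<le> b"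
    and ge: "a \<bullet> (x0, f x0) \<ge> b"
    by blast
  obtain a1 c where a: "a = (a1, c)" by (cases a)
  have leC: "a1 \<bullet> x + c * r \<le> a1 \<bullet> x0 + c * f x0" if "x \<in> S" "r < f x" for x r
    using le[of "(x, r)"] ge that by (auto simp: a C_def)
  have c0: "c \<ge> 0" using leC[OF x0, of "f x0 - 1"] by (simp add: algebra_simps)
  have leS: "a1 \<bullet> x + c * f x \<le> a1 \<bullet> x0 + c * f x0" if "x \<in> S" for x
  proof (rule field_le_epsilon)
    fix e :: real assume "e > 0"
    \<comment> \<open>The slack d stands for the limit of r towards f x; dividing by c + 1 rather
      than c covers c = 0, which is excluded only below.\<close>
    define d where "d = e / (c + 1)"
    have "d > 0" using \<open>e > 0\<close> c0 by (simp add: d_def)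
    then have "a1 \<bullet> x + c * (f x - d) \<le> a1 \<bullet> x0 + c * f x0" using leC[OF that] by simp
    moreover have "c * d \<le> e" using c0 \<open>e > 0\<close> by (simp add: d_def field_simps)
    ultimately show "a1 \<bullet> x + c * f x \<le> a1 \<bullet> x0 + c * f x0 + e" by (simp add: algebra_simps)
  qed
  \<comment> \<open>A vertical hyperplane would bound \<open>a1 \<bullet> x\<close> on all of S by
    its value at x0, which a step of length e in the direction of a1 violates.\<close>
  have "c \<noteq> 0"
  proof
    assume c: "c = 0"
    then have a1: "a1 \<noteq> 0" using a0 a by (auto simp: zero_prod_def)
    obtain e where e: "e > 0" "cball x0 e \<subseteq> S" using int by (auto simp: mem_interior_cball)
    define y where "y = x0 + (e / norm a1) *\<^sub>R a1"
    have "y \<in> cball x0 e" using a1 e by (simp add: y_def dist_norm)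
    then have "a1 \<bullet> y \<le> a1 \<bullet> x0" using leS[of y] e c by auto
    then have "(e / norm a1) * (a1 \<bullet> a1) \<le> 0" by (simp add: y_def inner_add_right)
    moreover have "(e / norm a1) * (a1 \<bullet> a1) > 0" using a1 e by simp
    ultimately show False by simp
  qed
  with c0 have c: "c > 0" by simp
  show thesis
  proof (rule that)
    fix x assume "x \<in> S"
    from leS[OF this] have "c * f x \<le> c * (f x0 + ((- 1 / c) *\<^sub>R a1) \<bullet> (x - x0))"
      using c by (simp add: inner_diff_right algebra_simps)
    then show "f x \<le> f x0 + ((- 1 / c) *\<^sub>R a1) \<bullet> (x - x0)" using c by simp
  qed
qed

text \<open>Composing with \<open>herm\<close> extends functions of self-adjoint matrices to all matrices, so that
  interiors, continuity and measurability refer to the full Euclidean space.\<close>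

definition herm :: "'n::finite cmat \<Rightarrow> 'n cmat" where
  "herm A = (1 / 2) *\<^sub>R (A + adj A)"

lemma self_adjoint_herm: "self_adjoint (herm A)"
  by (simp add: self_adjoint_def herm_def adj_scaleR adj_add add.commute)

lemma herm_self_adjoint: "self_adjoint A \<Longrightarrow> herm A = A"
  by (simp add: herm_def self_adjoint_def scaleR_2[symmetric])

lemma herm_linear: "herm (A + B) = herm A + herm B" "herm (r *\<^sub>R A) = r *\<^sub>R herm A"
  by (simp_all add: herm_def adj_add adj_scaleR scaleR_add_right)

lemma qf_herm: "qf (herm A) x = qf A x"
proof -
  have "qf (adj A) x = qf A x" by (simp add: qf_def inner_adj inner_commute)
  then show ?thesis by (simp add: herm_def qf_linear)
qed

lemma qf_bound:
  fixes A :: "'n::finite cmat"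
  shows "\<bar>qf A x\<bar> \<le> (real CARD('n))\<^sup>2 * norm A * (norm x)\<^sup>2"
proof -
  have e: "norm (A $ i $ j) \<le> norm A" for i j
    using Finite_Cartesian_Product.norm_nth_le[of "A $ i" j] Finite_Cartesian_Product.norm_nth_le[of A i] by linarith
  have "norm (A *v x) \<le> (\<Sum>i\<in>UNIV. norm ((A *v x) $ i))" by (rule norm_vec_le_sum)
  also have "\<dots> \<le> (\<Sum>i\<in>(UNIV::'n set). \<Sum>j\<in>(UNIV::'n set). norm A * norm x)"
    unfolding matrix_vector_mult_def vec_lambda_beta
    by (intro sum_mono order.trans[OF norm_sum])
      (auto intro!: mult_mono e Finite_Cartesian_Product.norm_nth_le simp: norm_mult)
  also have "\<dots> = (real CARD('n))\<^sup>2 * norm A * norm x" by (simp add: power2_eq_square)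
  finally have "norm x * norm (A *v x) \<le> norm x * ((real CARD('n))\<^sup>2 * norm A * norm x)"
    by (rule mult_left_mono) simp
  then show ?thesis
    using Cauchy_Schwarz_ineq2[of x "A *v x"] by (simp add: qf_def power2_eq_square mult_ac)
qed

lemma texp_shift: "self_adjoint A \<Longrightarrow> texp (A + c *\<^sub>R mat 1) = exp c * texp A"
proof (erule spectral_theorem)
  fix U l assume U: "unitary U" and A: "A = U ** dg l ** adj U"
  have "A + c *\<^sub>R mat 1 = U ** dg (\<lambda>i. l i + c * 1) ** adj U"
    by (simp only: A spectral_arith[OF U])
  then show ?thesis
    by (simp add: A texp_spectral[OF U] exp_add sum_distrib_left mult.commute)
qed

lemma texp_pos: "self_adjoint A \<Longrightarrow> 0 < texp A"
  by (erule spectral_theorem) (simp add: texp_spectral sum_pos)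

text \<open>The form of A - B is at most the scalar in the exponent, and a scalar shift comes out of
  \<open>texp\<close> as a factor. Being multiplicative, the estimate yields continuity and also
  control of relative errors.\<close>

lemma texp_herm_le:
  fixes A B :: "'n::finite cmat"
  shows "texp (herm A) \<le> exp ((real CARD('n))\<^sup>2 * norm (A - B)) * texp (herm B)"
proof -
  let ?c = "(real CARD('n))\<^sup>2 * norm (A - B)"
  have "texp (herm A) \<le> texp (herm B + ?c *\<^sub>R mat 1)"
  proof (rule texp_mono)
    show "psd (herm B + ?c *\<^sub>R mat 1 - herm A)"
      unfolding psd_def
    proof (intro conjI allI)
      fix x show "0 \<le> qf (herm B + ?c *\<^sub>R mat 1 - herm A) x"
        using qf_bound[of "A - B" x] by (simp add: qf_linear qf_herm)
    qed (intro self_adjoint_intros self_adjoint_herm)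
  qed (intro self_adjoint_intros self_adjoint_herm)+
  then show ?thesis by (simp add: texp_shift self_adjoint_herm)
qed

lemma continuous_texp_herm: "continuous_on UNIV (\<lambda>A :: 'n::finite cmat. texp (herm A))"
proof (clarsimp simp: continuous_on_eq_continuous_at isCont_def)
  fix A :: "'n cmat"
  let ?c = "\<lambda>B. (real CARD('n))\<^sup>2 * norm (A - B)"
  show "((\<lambda>B. texp (herm B)) \<longlongrightarrow> texp (herm A)) (at A)"
  proof (rule tendsto_sandwich)
    show "\<forall>\<^sub>F B in at A. exp (- ?c B) * texp (herm A) \<le> texp (herm B)"
    proof (rule always_eventually, rule allI)
      fix B
      show "exp (- ?c B) * texp (herm A) \<le> texp (herm B)"
        using texp_herm_le[of A B] by (simp add: exp_minus field_simps)
    qed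
    show "\<forall>\<^sub>F B in at A. texp (herm B) \<le> exp (?c B) * texp (herm A)"
      by (intro always_eventually allI) (metis texp_herm_le norm_minus_commute)
    have "((\<lambda>B. exp (- ?c B) * texp (herm A)) \<longlongrightarrow> exp (- ?c A) * texp (herm A)) (at A)"
      by (intro tendsto_intros)
    then show "((\<lambda>B. exp (- ?c B) * texp (herm A)) \<longlongrightarrow> texp (herm A)) (at A)" by simp
    have "((\<lambda>B. exp (?c B) * texp (herm A)) \<longlongrightarrow> exp (?c A) * texp (herm A)) (at A)"
      by (intro tendsto_intros)
    then show "((\<lambda>B. exp (?c B) * texp (herm A)) \<longlongrightarrow> texp (herm A)) (at A)" by simp
  qed
qed

text \<open>Behind this stands that (exp y - 1 - y) / y^2 is increasing. The value 1/2 bounds the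
  ratio from above for negative y and from below at c; for positive y the exponential series are
  compared term by term.\<close>

lemma exp_quadratic_bound:
  fixes y c :: real
  assumes "y \<le> c" "0 < c"
  shows "exp y \<le> 1 + y + y\<^sup>2 / c\<^sup>2 * (exp c - 1 - c)"
proof (cases "y \<le> 0")
  case True
  define z where "z = - y"
  have z: "z \<ge> 0" using True by (simp add: z_def)
  \<comment> \<open>The quadratic Taylor polynomials at z and - z multiply to 1 + z^4 / 4, so the
    lower bound for exp z turns into an upper bound for exp (- z).\<close>
  have "1 \<le> 1 + z ^ 4 / 4" by simp
  also have "\<dots> = (1 + z + z\<^sup>2 / 2) * (1 - z + z\<^sup>2 / 2)"
    by (simp add: power2_eq_square power4_eq_xxxx algebra_simps)
  also have "\<dots> \<le> exp z * (1 - z + z\<^sup>2 / 2)"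
  proof (rule mult_right_mono[OF exp_lower_Taylor_quadratic[OF z]])
    have "1 - z + z\<^sup>2 / 2 = (1 - z)\<^sup>2 / 2 + 1 / 2" by (simp add: power2_eq_square field_simps)
    then show "0 \<le> 1 - z + z\<^sup>2 / 2" by simp
  qed
  finally have "exp (- z) \<le> 1 - z + z\<^sup>2 / 2" by (simp add: exp_minus field_simps)
  then have "exp y \<le> 1 + y + y\<^sup>2 * (1 / 2)" by (simp add: z_def)
  also have "y\<^sup>2 * (1 / 2) \<le> y\<^sup>2 * ((exp c - 1 - c) / c\<^sup>2)"
    using exp_lower_Taylor_quadratic[of c] assms(2) by (intro mult_left_mono) (auto simp: field_simps)
  finally show ?thesis by simp
next
  case False
  then have y: "0 < y" by simp
  have s: "(\<lambda>n. x ^ (n + 2) / fact (n + 2)) sums (exp x - 1 - x)" for x :: real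
    using sums_split_initial_segment[OF exp_converges[of x], of 2]
    by (simp add: numeral_2_eq_2 divide_inverse mult.commute algebra_simps)
  have "y ^ (n + 2) / fact (n + 2) \<le> (y\<^sup>2 / c\<^sup>2) * (c ^ (n + 2) / fact (n + 2))" for n
  proof -
    have "y ^ (n + 2) = y\<^sup>2 * y ^ n" by (simp add: power_add power2_eq_square)
    also have "\<dots> \<le> y\<^sup>2 * c ^ n" using y assms by (intro mult_left_mono power_mono) auto
    also have "\<dots> = (y\<^sup>2 / c\<^sup>2) * c ^ (n + 2)" using assms by (simp add: power_add power2_eq_square)
    finally have "y ^ (n + 2) / fact (n + 2) \<le> (y\<^sup>2 / c\<^sup>2) * c ^ (n + 2) / fact (n + 2)"
      by (rule divide_right_mono) simp
    then show ?thesis by (simp only: times_divide_eq_right)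
  qed
  then have "exp y - 1 - y \<le> (y\<^sup>2 / c\<^sup>2) * (exp c - 1 - c)"
    by (rule sums_le[OF _ s sums_mult[OF s]])
  then show ?thesis by simp
qed

lemma bernstein_coeff_nonneg: "0 \<le> (exp x - x - 1) / R\<^sup>2" for x R :: real
proof (rule divide_nonneg_nonneg)
  show "0 \<le> exp x - x - 1" using exp_ge_add_one_self[of x] by linarith
qed simp

text \<open>The order of quantifiers matters: a is chosen before X and depends on H and V only, so
  conditional expectation can act on the right-hand side. The term in a then averages to zero when X
  has conditional mean zero and V is the conditional mean of X^2.\<close>

lemma texp_increment_bound:
  fixes H V :: "'n::finite cmat" and R \<theta> g :: real
  assumes H: "self_adjoint H" and V: "psd V" and R: "R > 0" and \<theta>: "\<theta> > 0"
    and g: "g = (exp (\<theta> * R) - \<theta> * R - 1) / R\<^sup>2"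
  obtains a where "\<And>X. self_adjoint X \<Longrightarrow> psd (R *\<^sub>R mat 1 - X) \<Longrightarrow>
      texp (H + \<theta> *\<^sub>R X - g *\<^sub>R V) \<le> texp H + a \<bullet> (\<theta> *\<^sub>R X + g *\<^sub>R (X ** X) - g *\<^sub>R V)"
proof -
  have g0: "g \<ge> 0"
    unfolding g by (rule bernstein_coeff_nonneg)
  have Vsa: "self_adjoint V" using V by (simp add: psd_def)
  \<comment> \<open>K collects everything known before X, so that X enters only through the argument
    of Lieb's function.\<close>
  define K where "K = H - g *\<^sub>R V"
  have K: "self_adjoint K" unfolding K_def by (intro self_adjoint_intros H Vsa)
  define A0 where "A0 = mat 1 + g *\<^sub>R V"
  define S where "S = {A :: 'n cmat. pd (herm A)}"
  define f where "f A = texp (K + mfun ln (herm A))" for A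
  have A0: "pd A0" "self_adjoint A0" "\<And>x. (norm x)\<^sup>2 \<le> qf A0 x"
  proof -
    show q: "(norm x)\<^sup>2 \<le> qf A0 x" for x using V g0 by (simp add: A0_def qf_linear psd_def)
    show sa: "self_adjoint A0" unfolding A0_def by (intro self_adjoint_intros Vsa)
    show "pd A0" unfolding pd_def using sa q by (metis less_le_trans zero_less_norm_iff zero_less_power)
  qed
  have "convex S"
    by (rule convexI) (simp add: S_def herm_linear pd_convex_comb)
  moreover have "u * f x + v * f y \<le> f (u *\<^sub>R x + v *\<^sub>R y)"
    if "x \<in> S" "y \<in> S" "0 \<le> u" "0 \<le> v" "u + v = 1" for x y u v
    using that by (simp add: S_def f_def herm_linear lieb_concavity[OF K])
  moreover have "A0 \<in> interior S"
    unfolding mem_interior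
  proof (intro exI conjI subsetI)
    \<comment> \<open>By \<open>qf_bound\<close>, within this radius the form of
      \<open>A0 - B\<close> stays strictly below the squared norm at nonzero vectors, while that of
      \<open>A0\<close> is at least the squared norm.\<close>
    define e where "e = 1 / (real CARD('n))\<^sup>2"
    show "e > 0" by (simp add: e_def)
    fix B assume "B \<in> ball A0 e"
    then have B: "norm (A0 - B) < e" by (simp add: dist_norm)
    have "0 < qf B x" if "x \<noteq> 0" for x
    proof -
      have "qf A0 x - qf B x \<le> (real CARD('n))\<^sup>2 * norm (A0 - B) * (norm x)\<^sup>2"
        using qf_bound[of "A0 - B" x] by (simp add: qf_linear)
      also have "(real CARD('n))\<^sup>2 * norm (A0 - B) < 1" using B by (simp add: e_def field_simps)
      then have "(real CARD('n))\<^sup>2 * norm (A0 - B) * (norm x)\<^sup>2 < 1 * (norm x)\<^sup>2"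
        using that by (intro mult_strict_right_mono) auto
      finally show ?thesis using A0(3)[of x] by simp
    qed
    then show "B \<in> S" by (simp add: S_def pd_def self_adjoint_herm qf_herm)
  qed
  ultimately obtain a where a: "\<And>A. A \<in> S \<Longrightarrow> f A \<le> f A0 + a \<bullet> (A - A0)"
    using concave_supergradient[of S f A0] by metis
  \<comment> \<open>This is ln (1 + x) \<le> x at the eigenvalues of g V: subtracting g V in K pays
    for the choice of the tangent point.\<close>
  have fA0: "f A0 \<le> texp H"
  proof -
    obtain U l where U: "unitary U" and Veq: "V = U ** dg l ** adj U" and l: "\<And>i. 0 \<le> l i"
      using psd_obtain[OF V] by blast
    have A0eq: "A0 = U ** dg (\<lambda>i. 1 + g * l i) ** adj U"
      unfolding A0_def Veq spectral_arith(4)[OF U] spectral_arith(1,3)[OF U] ..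
    have "H - (K + mfun ln A0) = U ** dg (\<lambda>i. g * l i - ln (1 + g * l i)) ** adj U"
      by (simp add: K_def A0eq mfun_eq[OF U] Veq spectral_arith(2,3)[OF U])
    moreover have "0 \<le> g * l i - ln (1 + g * l i)" for i
      using ln_add_one_self_le_self[of "g * l i"] g0 l[of i] by simp
    ultimately have "psd (H - (K + mfun ln A0))" by (simp add: psd_spectral)
    then show ?thesis unfolding f_def herm_self_adjoint[OF A0(2)]
      by (intro texp_mono) (intro self_adjoint_intros self_adjoint_mfun K H A0)+
  qed
  show thesis
  proof (rule that)
    fix X :: "'n cmat" assume X: "self_adjoint X" and XR: "psd (R *\<^sub>R mat 1 - X)"
    obtain U l where U: "unitary U" and Xeq: "X = U ** dg l ** adj U"
      using spectral_theorem[OF X] by blast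
    have "R *\<^sub>R mat 1 - X = U ** dg (\<lambda>i. R * 1 - l i) ** adj U"
      by (simp only: Xeq spectral_arith[OF U])
    then have "0 \<le> R * 1 - l i" for i
      using XR eigenvalue_qf[OF U, of "\<lambda>i. R * 1 - l i" i] by (metis psd_def)
    then have lR: "l i \<le> R" for i by simp
    define A where "A = U ** dg (\<lambda>i. exp (\<theta> * l i)) ** adj U"
    \<comment> \<open>A and B are functions of X, so they share its eigenbasis and the scalar
      exponential bound transfers eigenvalue by eigenvalue.\<close>
    define B where "B = mat 1 + \<theta> *\<^sub>R X + g *\<^sub>R (X ** X)"
    have Beq: "B = U ** dg (\<lambda>i. 1 + \<theta> * l i + g * (l i * l i)) ** adj U"
      unfolding B_def Xeq spectral_arith(4)[OF U] spectral_arith(1,3,5)[OF U] ..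
    have sc: "exp (\<theta> * l i) \<le> 1 + \<theta> * l i + g * (l i * l i)" for i
    proof -
      have "exp (\<theta> * l i) \<le> 1 + \<theta> * l i + (\<theta> * l i)\<^sup>2 / (\<theta> * R)\<^sup>2 * (exp (\<theta> * R) - 1 - \<theta> * R)"
        by (rule exp_quadratic_bound) (use lR \<theta> R in simp_all)
      also have "(\<theta> * l i)\<^sup>2 / (\<theta> * R)\<^sup>2 * (exp (\<theta> * R) - 1 - \<theta> * R) = g * (l i * l i)"
        using \<theta> R by (simp add: g power_mult_distrib power2_eq_square field_simps)
      finally show ?thesis .
    qed
    have A: "pd A" unfolding A_def by (intro pd_spectral U) simp
    have B: "pd B" unfolding Beq by (intro pd_spectral U) (use sc less_le_trans exp_gt_zero in blast)
    have AB: "psd (B - A)"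
      unfolding Beq A_def spectral_arith(2)[OF U] by (intro psd_spectral) (simp add: sc)
    have lnA: "mfun ln A = \<theta> *\<^sub>R X"
      by (simp add: A_def mfun_eq[OF U] Xeq spectral_arith[OF U])
    have Bsa: "self_adjoint B" using B by (simp add: pd_def)
    have "texp (H + \<theta> *\<^sub>R X - g *\<^sub>R V) = texp (K + mfun ln A)"
      by (simp add: lnA K_def algebra_simps)
    also have "\<dots> \<le> texp (K + mfun ln B)" by (rule texp_add_ln_mono[OF K A B AB])
    also have "\<dots> = f B" by (simp add: f_def herm_self_adjoint[OF Bsa])
    also have "\<dots> \<le> f A0 + a \<bullet> (B - A0)"
      by (rule a) (simp add: S_def herm_self_adjoint[OF Bsa] B)
    also have "\<dots> \<le> texp H + a \<bullet> (B - A0)" using fA0 by simp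
    also have "B - A0 = \<theta> *\<^sub>R X + g *\<^sub>R (X ** X) - g *\<^sub>R V"
      by (simp add: B_def A0_def)
    finally show "texp (H + \<theta> *\<^sub>R X - g *\<^sub>R V) \<le> texp H + a \<bullet> (\<theta> *\<^sub>R X + g *\<^sub>R (X ** X) - g *\<^sub>R V)" .
  qed
qed

section \<open>Largest eigenvalue and spectral norm\<close>

lemma real_eigenvalues_spectral:
  assumes U: "unitary U"
  shows "{x. complex_of_real x \<in> eigenvalues (U ** dg l ** adj U)} = range l"
proof (intro set_eqI iffI)
  fix x assume "x \<in> {x. complex_of_real x \<in> eigenvalues (U ** dg l ** adj U)}"
  then obtain v where v: "v \<noteq> 0" "(U ** dg l ** adj U) *v v = of_real x *s v"
    by (auto simp: eigenvalues_def)
  define w where "w = adj U *v v"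
  have Uw: "U *v w = v" by (simp add: w_def matrix_vector_mul_assoc unitaryD[OF U])
  then have "w \<noteq> 0" using v by auto
  then obtain i where i: "w $ i \<noteq> 0" by (auto simp: vec_eq_iff)
  have "adj U *v ((U ** dg l ** adj U) *v v) = dg l *v w"
    by (simp add: w_def matrix_vector_mul_assoc matrix_mul_assoc unitaryD[OF U])
  also have "\<dots> $ i = of_real (l i) * w $ i"
    by (simp add: matrix_vector_mult_def dg_def if_distrib[of "\<lambda>x. x * _"] cong: if_cong)
  finally have "(adj U *v (of_real x *s v)) $ i = of_real (l i) * w $ i" unfolding v .
  moreover have "(adj U *v (of_real x *s v)) $ i = of_real x * w $ i"
    by (simp add: w_def matrix_vector_mult_def sum_distrib_left mult_ac)
  ultimately have "x = l i" using i by simp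
  then show "x \<in> range l" by simp
next
  fix x assume "x \<in> range l"
  then obtain i where x: "x = l i" by auto
  have "(U ** dg l ** adj U) ** U = U ** dg l" by (simp add: unitary_cancel[OF U])
  then have "((U ** dg l ** adj U) ** U) $ k $ i = U $ k $ i * of_real (l i)" for k
    by (simp add: dg_mult_right)
  then have "(U ** dg l ** adj U) *v column i U = of_real (l i) *s column i U"
    by (simp add: vec_eq_iff matrix_vector_mult_def column_def matrix_mult_nth mult.commute)
  then show "x \<in> {x. complex_of_real x \<in> eigenvalues (U ** dg l ** adj U)}"
    using unitary_column_nz[OF U, of i] by (auto simp: eigenvalues_def x)
qed

lemma lambda_max_le_imp_psd:
  assumes "self_adjoint A" "lambda_max A \<le> R"
  shows "psd (R *\<^sub>R mat 1 - A)"
proof -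
  obtain U l where U: "unitary U" and A: "A = U ** dg l ** adj U"
    using spectral_theorem[OF assms(1)] by blast
  have "l i \<le> R" for i
    using assms(2) Max_ge[of "range l" "l i"]
    unfolding lambda_max_def A real_eigenvalues_spectral[OF U] by auto
  moreover have "R *\<^sub>R mat 1 - A = U ** dg (\<lambda>i. R * 1 - l i) ** adj U"
    by (simp only: A spectral_arith[OF U])
  ultimately show ?thesis by (simp add: psd_spectral)
qed

lemma spectral_norm_le_imp_psd:
  assumes "self_adjoint A" "spectral_norm A \<le> R"
  shows "psd (R *\<^sub>R mat 1 - A)"
proof -
  obtain U l where U: "unitary U" and A: "A = U ** dg l ** adj U"
    using spectral_theorem[OF assms(1)] by blast
  have "adj A ** A = U ** dg (\<lambda>i. l i * l i) ** adj U"
    using assms(1) by (simp add: self_adjoint_def A spectral_arith[OF U])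
  then have "singular_values A = {s. 0 \<le> s \<and> s\<^sup>2 \<in> range (\<lambda>i. l i * l i)}"
    using real_eigenvalues_spectral[OF U, of "\<lambda>i. l i * l i"]
    by (simp add: singular_values_def set_eq_iff del: of_real_power)
  also have "\<dots> = range (\<lambda>i. \<bar>l i\<bar>)"
    by (auto simp: power2_eq_square[symmetric] power2_eq_iff_nonneg dest: arg_cong[of _ _ sqrt])
  finally have "\<bar>l i\<bar> \<le> R" for i
    using assms(2) Max_ge[of "range (\<lambda>i. \<bar>l i\<bar>)" "\<bar>l i\<bar>"] unfolding spectral_norm_def by auto
  then have "l i \<le> R" for i by (metis abs_le_D1)
  moreover have "R *\<^sub>R mat 1 - A = U ** dg (\<lambda>i. R * 1 - l i) ** adj U"
    by (simp only: A spectral_arith[OF U])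
  ultimately show ?thesis by (simp add: psd_spectral)
qed

lemma exp_lambda_max_le_texp:
  assumes "self_adjoint A" "0 \<le> \<theta>"
  shows "exp (\<theta> * lambda_max A) \<le> texp (\<theta> *\<^sub>R A)"
proof -
  obtain U l where U: "unitary U" and A: "A = U ** dg l ** adj U"
    using spectral_theorem[OF assms(1)] by blast
  have "lambda_max A \<in> range l"
    unfolding lambda_max_def A real_eigenvalues_spectral[OF U] by (rule Max_in) auto
  then obtain i where "lambda_max A = l i" by auto
  then have "exp (\<theta> * lambda_max A) \<le> (\<Sum>i\<in>UNIV. exp (\<theta> * l i))"
    using member_le_sum[of i UNIV "\<lambda>i. exp (\<theta> * l i)"] by simp
  then show ?thesis by (simp add: A spectral_arith[OF U] texp_spectral[OF U])
qed

text \<open>The norm bound puts W below s as a form, so - g W lies above the scalar - g s, which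
  comes out of the trace exponential as a factor. What remains dominates the exponential of the
  largest eigenvalue of \<theta> Y.\<close>

lemma texp_ge_on_event:
  assumes Y: "self_adjoint Y" "t \<le> lambda_max Y" and W: "self_adjoint W" "spectral_norm W \<le> s"
    and "0 \<le> \<theta>" "0 \<le> g"
  shows "exp (\<theta> * t - g * s) \<le> texp (\<theta> *\<^sub>R Y - g *\<^sub>R W)"
proof -
  have "exp (\<theta> * t) \<le> exp (\<theta> * lambda_max Y)" using assms by (simp add: mult_left_mono)
  also have "\<dots> \<le> texp (\<theta> *\<^sub>R Y)" using assms by (intro exp_lambda_max_le_texp)
  finally have "exp (- (g * s)) * exp (\<theta> * t) \<le> exp (- (g * s)) * texp (\<theta> *\<^sub>R Y)" by simp
  also have "\<dots> = texp (\<theta> *\<^sub>R Y + (- (g * s)) *\<^sub>R mat 1)"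
    by (simp only: texp_shift self_adjoint_scaleR Y)
  also have "\<dots> \<le> texp (\<theta> *\<^sub>R Y - g *\<^sub>R W)"
  proof (rule texp_mono)
    have "psd (s *\<^sub>R mat 1 - W)" by (rule spectral_norm_le_imp_psd[OF W])
    then show "psd (\<theta> *\<^sub>R Y - g *\<^sub>R W - (\<theta> *\<^sub>R Y + (- (g * s)) *\<^sub>R mat 1))"
      using \<open>0 \<le> g\<close> W Y unfolding psd_def
      by (auto intro!: self_adjoint_intros simp: qf_linear mult_left_mono mult.assoc)
  qed (intro self_adjoint_intros Y W)+
  finally show ?thesis by (simp add: exp_diff exp_minus field_simps)
qed

section \<open>Matrix conditional expectation\<close>

lemma inner_cmat:
  "a \<bullet> Z = (\<Sum>i\<in>UNIV. \<Sum>j\<in>UNIV. Re (a $ i $ j) * Re (Z $ i $ j) + Im (a $ i $ j) * Im (Z $ i $ j))"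
  for a Z :: "'n::finite cmat"
  by (simp add: inner_vec_def inner_complex_def)

lemma set_integral_sum:
  fixes f :: "'i \<Rightarrow> 'a \<Rightarrow> real"
  assumes "A \<in> sets M" "\<And>i. i \<in> I \<Longrightarrow> integrable M (f i)"
  shows "(LINT \<omega>:A|M. (\<Sum>i\<in>I. f i \<omega>)) = (\<Sum>i\<in>I. LINT \<omega>:A|M. f i \<omega>)"
  unfolding set_lebesgue_integral_def scaleR_sum_right
  by (intro Bochner_Integration.integral_sum integrable_mult_indicator assms)

lemma set_integrable_of_integrable:
  fixes f :: "'a \<Rightarrow> real"
  shows "A \<in> sets M \<Longrightarrow> integrable M f \<Longrightarrow> set_integrable M A f"
  unfolding set_integrable_def by (rule integrable_mult_indicator)

lemma prob_sigma_finite_subalgebra: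
  assumes "prob_space M" "subalgebra M G"
  shows "sigma_finite_subalgebra M G"
proof -
  interpret prob_space M by fact
  show ?thesis
    by (intro finite_measure_subalgebra_is_sigma_finite finite_measure_subalgebra.intro
        finite_measure_subalgebra_axioms.intro finite_measure_axioms assms)
qed

lemma integrable_entries:
  fixes Z :: "'a \<Rightarrow> 'n::finite cmat"
  assumes "integrable M Z"
  shows "integrable M (\<lambda>\<omega>. Re (Z \<omega> $ i $ j))" "integrable M (\<lambda>\<omega>. Im (Z \<omega> $ i $ j))"
proof -
  have "bounded_linear (\<lambda>A :: 'n cmat. A $ i $ j)"
    by (rule bounded_linear_compose[OF bounded_linear_vec_nth bounded_linear_vec_nth])
  then have "integrable M (\<lambda>\<omega>. Z \<omega> $ i $ j)" by (rule integrable_bounded_linear) fact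
  then show "integrable M (\<lambda>\<omega>. Re (Z \<omega> $ i $ j))" "integrable M (\<lambda>\<omega>. Im (Z \<omega> $ i $ j))" by auto
qed

text \<open>A real functional of the matrix is a real combination of the real and imaginary parts of
  its entries, so it passes through the entrywise definition. This is the form in which the tangent
  bound meets conditional expectation.\<close>

lemma
  fixes Z :: "'a \<Rightarrow> 'n::finite cmat"
  assumes M: "prob_space M" and G: "subalgebra M G" and Z: "integrable M Z"
  shows integrable_inner_mat_cond_exp: "integrable M (\<lambda>\<omega>. a \<bullet> mat_cond_exp M G Z \<omega>)"
    and set_integral_inner_mat_cond_exp: "A \<in> sets G \<Longrightarrow>
      (LINT \<omega>:A|M. a \<bullet> mat_cond_exp M G Z \<omega>) = (LINT \<omega>:A|M. a \<bullet> Z \<omega>)"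
proof -
  interpret sigma_finite_subalgebra M G by (rule prob_sigma_finite_subalgebra[OF M G])
  note e = integrable_entries[OF Z]
  note r = real_cond_exp_int(1)[OF e(1)] real_cond_exp_int(1)[OF e(2)]
  have eq: "a \<bullet> mat_cond_exp M G Z \<omega> = (\<Sum>i\<in>UNIV. \<Sum>j\<in>UNIV.
      Re (a $ i $ j) * real_cond_exp M G (\<lambda>\<omega>. Re (Z \<omega> $ i $ j)) \<omega>
      + Im (a $ i $ j) * real_cond_exp M G (\<lambda>\<omega>. Im (Z \<omega> $ i $ j)) \<omega>)" for \<omega>
    by (simp add: inner_cmat mat_cond_exp_def)
  show "integrable M (\<lambda>\<omega>. a \<bullet> mat_cond_exp M G Z \<omega>)"
    unfolding eq by (intro Bochner_Integration.integrable_sum Bochner_Integration.integrable_add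
        integrable_mult_right r)
  assume A: "A \<in> sets G"
  then have AM: "A \<in> sets M" using G by (auto simp: subalgebra_def)
  note si = set_integrable_of_integrable[OF AM]
  have term_eq: "(LINT \<omega>:A|M. u * real_cond_exp M G f \<omega> + v * real_cond_exp M G g \<omega>)
      = (LINT \<omega>:A|M. u * f \<omega> + v * g \<omega>)"
    if "integrable M f" "integrable M g" for f g and u v :: real
    using that by (simp add: set_integral_add set_integral_mult_right si real_cond_exp_int(1)
        real_cond_exp_intA[OF _ A, symmetric] integrable_mult_right)
  show "(LINT \<omega>:A|M. a \<bullet> mat_cond_exp M G Z \<omega>) = (LINT \<omega>:A|M. a \<bullet> Z \<omega>)"
    unfolding eq unfolding inner_cmat
    by (simp add: set_integral_sum AM e r term_eq)
qed

lemma measurable_mat_cond_exp: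
  fixes Z :: "'a \<Rightarrow> 'n::finite cmat"
  shows "mat_cond_exp M G Z \<in> borel_measurable G"
proof (rule iffD2[OF borel_measurable_euclidean_space], intro ballI)
  fix b :: "'n cmat"
  have "(\<lambda>\<omega>. b \<bullet> mat_cond_exp M G Z \<omega>) \<in> borel_measurable G"
    unfolding inner_cmat mat_cond_exp_def by simp measurable
  then show "(\<lambda>\<omega>. mat_cond_exp M G Z \<omega> \<bullet> b) \<in> borel_measurable G" by (simp only: inner_commute)
qed

lemma AE_inner_mat_cond_exp_nonneg:
  fixes Z :: "'a \<Rightarrow> 'n::finite cmat"
  assumes M: "prob_space M" and G: "subalgebra M G" and Z: "integrable M Z"
    and nonneg: "\<And>\<omega>. \<omega> \<in> space M \<Longrightarrow> 0 \<le> a \<bullet> Z \<omega>"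
  shows "AE \<omega> in M. 0 \<le> a \<bullet> mat_cond_exp M G Z \<omega>"
proof -
  interpret sigma_finite_subalgebra M G by (rule prob_sigma_finite_subalgebra[OF M G])
  have int: "integrable M (\<lambda>\<omega>. a \<bullet> Z \<omega>)"
    by (rule integrable_inner_right) (rule Z)
  have "AE \<omega> in M. real_cond_exp M G (\<lambda>\<omega>. a \<bullet> Z \<omega>) \<omega> = a \<bullet> mat_cond_exp M G Z \<omega>"
  proof (rule real_cond_exp_charact)
    have [measurable]: "mat_cond_exp M G Z \<in> borel_measurable G" by (rule measurable_mat_cond_exp)
    show "(\<lambda>\<omega>. a \<bullet> mat_cond_exp M G Z \<omega>) \<in> borel_measurable G" by measurable
  qed (simp_all add: int integrable_inner_mat_cond_exp[OF M G Z] set_integral_inner_mat_cond_exp[OF M G Z])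
  moreover have "AE \<omega> in M. 0 \<le> real_cond_exp M G (\<lambda>\<omega>. a \<bullet> Z \<omega>) \<omega>"
    by (rule real_cond_exp_pos) (use nonneg int in auto)
  ultimately show ?thesis by eventually_elim simp
qed

lemma AE_inner_mat_cond_exp_zero:
  fixes Z :: "'a \<Rightarrow> 'n::finite cmat"
  assumes M: "prob_space M" and G: "subalgebra M G" and Z: "integrable M Z"
    and zero: "\<And>\<omega>. \<omega> \<in> space M \<Longrightarrow> a \<bullet> Z \<omega> = 0"
  shows "AE \<omega> in M. a \<bullet> mat_cond_exp M G Z \<omega> = 0"
proof -
  have "AE \<omega> in M. 0 \<le> a \<bullet> mat_cond_exp M G Z \<omega>" "AE \<omega> in M. 0 \<le> (- a) \<bullet> mat_cond_exp M G Z \<omega>"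
    by (intro AE_inner_mat_cond_exp_nonneg M G Z; simp add: zero)+
  then show ?thesis by eventually_elim simp
qed

text \<open>Every entry has its own version of the conditional expectation, so symmetry is obtained
  only almost everywhere. It amounts to the vanishing of finitely many real functionals: differences
  of real parts and sums of imaginary parts of the entries (i, j) and (j, i).\<close>

lemma AE_self_adjoint_mat_cond_exp:
  fixes Z :: "'a \<Rightarrow> 'n::finite cmat"
  assumes M: "prob_space M" and G: "subalgebra M G" and Z: "integrable M Z"
    and sa: "\<And>\<omega>. \<omega> \<in> space M \<Longrightarrow> self_adjoint (Z \<omega>)"
  shows "AE \<omega> in M. self_adjoint (mat_cond_exp M G Z \<omega>)"
proof -
  let ?E = "\<lambda>i j c. axis i (axis j c) :: 'n cmat"
  have E: "?E i j c \<bullet> A = c \<bullet> (A $ i $ j)" for i j c A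
    by (simp add: inner_axis')
  have sym: "Re (Z \<omega> $ i $ j) = Re (Z \<omega> $ j $ i)" "Im (Z \<omega> $ i $ j) = - Im (Z \<omega> $ j $ i)"
    if "\<omega> \<in> space M" for \<omega> i j
    using self_adjointD[OF sa[OF that], of j i] by (auto simp: complex_eq_iff)
  have "AE \<omega> in M. (?E i j 1 - ?E j i 1) \<bullet> mat_cond_exp M G Z \<omega> = 0"
    "AE \<omega> in M. (?E i j \<i> + ?E j i \<i>) \<bullet> mat_cond_exp M G Z \<omega> = 0" for i j
    by (rule AE_inner_mat_cond_exp_zero[OF M G Z];
        simp add: inner_diff_left inner_add_left E inner_complex_def; metis sym add.left_inverse)+
  then have "AE \<omega> in M. \<forall>i j. (?E i j 1 - ?E j i 1) \<bullet> mat_cond_exp M G Z \<omega> = 0 \<and>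
      (?E i j \<i> + ?E j i \<i>) \<bullet> mat_cond_exp M G Z \<omega> = 0"
    by (simp only: AE_all_countable AE_conj_iff) blast
  then show ?thesis
    by eventually_elim
      (auto simp: self_adjoint_def vec_eq_iff complex_eq_iff inner_diff_left inner_add_left E
        inner_complex_def neg_eq_iff_add_eq_0)
qed

lemma qf_square_nonneg: "self_adjoint A \<Longrightarrow> 0 \<le> qf (A ** A) x"
  using qf_sandwich[of A "mat 1" x] by (simp add: self_adjoint_def qf_linear)

text \<open>For a fixed vector the form is nonnegative outside a null set depending on the vector. A
  countable dense set of vectors provides a common null set, and continuity of the form extends the
  inequality to all vectors.\<close>

lemma AE_psd_mat_cond_exp_square:
  fixes X :: "'a \<Rightarrow> 'n::finite cmat"
  assumes M: "prob_space M" and G: "subalgebra M G" and X: "integrable M (\<lambda>\<omega>. X \<omega> ** X \<omega>)"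
    and sa: "\<And>\<omega>. \<omega> \<in> space M \<Longrightarrow> self_adjoint (X \<omega>)"
  shows "AE \<omega> in M. psd (mat_cond_exp M G (\<lambda>\<omega>. X \<omega> ** X \<omega>) \<omega>)"
proof -
  let ?V = "mat_cond_exp M G (\<lambda>\<omega>. X \<omega> ** X \<omega>)"
  obtain D :: "(complex ^ 'n) set" where D: "countable D"
    and dense: "\<And>S. open S \<Longrightarrow> S \<noteq> {} \<Longrightarrow> \<exists>d\<in>D. d \<in> S"
    using countable_dense_exists by blast
  have lin: "qf A x = (\<chi> i j. x $ i * cnj (x $ j)) \<bullet> A" for A and x :: "complex ^ 'n"
    by (simp add: qf_def inner_vec_def matrix_vector_mult_def inner_complex_Re sum_distrib_left mult_ac
        del: Re_sum times_complex.sel flip: Re_sum)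
  have "AE \<omega> in M. 0 \<le> qf (?V \<omega>) x" for x
    unfolding lin
    by (rule AE_inner_mat_cond_exp_nonneg[OF M G X]) (simp add: lin[symmetric] qf_square_nonneg sa)
  then have "AE \<omega> in M. \<forall>x\<in>D. 0 \<le> qf (?V \<omega>) x"
    using D by (simp add: AE_ball_countable)
  moreover have "AE \<omega> in M. self_adjoint (?V \<omega>)"
    by (rule AE_self_adjoint_mat_cond_exp[OF M G X]) (simp add: self_adjoint_square sa)
  ultimately show ?thesis
  proof eventually_elim
    case (elim \<omega>)
    have "0 \<le> qf (?V \<omega>) x" for x
    proof (rule ccontr)
      assume "\<not> 0 \<le> qf (?V \<omega>) x"
      then have "{x. qf (?V \<omega>) x < 0} \<noteq> {}" using not_le by blast
      moreover have "open {x. qf (?V \<omega>) x < 0}"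
        unfolding lin inner_cmat by (intro open_Collect_less continuous_intros)
      ultimately show False using dense elim(1) by (force simp: not_less[symmetric])
    qed
    then show ?case using elim(2) by (simp add: psd_def)
  qed
qed

section \<open>The supermartingale\<close>

text \<open>The tangent at (H0, V0) serves all nearby pairs. Replacing the exponent on the left and
  comparing \<open>texp H0\<close> with \<open>texp H\<close> cost exp \<delta> each; exchanging V0
  for V inside the tangent costs \<delta> times \<open>texp H0\<close>. Positivity of
  \<open>texp H0\<close> is what lets these errors be relative.\<close>

lemma texp_increment_bound_local:
  fixes H0 V0 :: "'n::finite cmat" and R \<theta> g \<delta> :: real
  assumes H0: "self_adjoint H0" and V0: "psd V0" and R: "R > 0" and \<theta>: "\<theta> > 0"
    and g: "g = (exp (\<theta> * R) - \<theta> * R - 1) / R\<^sup>2" and \<delta>: "\<delta> > 0"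
  shows "\<exists>r a m. 0 < r \<and> 0 \<le> m \<and> (\<forall>H V. (H, V) \<in> ball (H0, V0) r \<and> self_adjoint H \<and> psd V \<longrightarrow>
      m \<le> exp (2 * \<delta>) * (1 + \<delta>) * texp H \<and>
      (\<forall>X. self_adjoint X \<and> psd (R *\<^sub>R mat 1 - X) \<longrightarrow>
        texp (H + \<theta> *\<^sub>R X - g *\<^sub>R V) \<le> m + a \<bullet> (\<theta> *\<^sub>R X + g *\<^sub>R (X ** X) - g *\<^sub>R V)))"
proof -
  have g0: "g \<ge> 0"
    unfolding g by (rule bernstein_coeff_nonneg)
  obtain a where a: "\<And>X. self_adjoint X \<Longrightarrow> psd (R *\<^sub>R mat 1 - X) \<Longrightarrow>
      texp (H0 + \<theta> *\<^sub>R X - g *\<^sub>R V0) \<le> texp H0 + a \<bullet> (\<theta> *\<^sub>R X + g *\<^sub>R (X ** X) - g *\<^sub>R V0)"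
    using texp_increment_bound[OF H0 V0 R \<theta> g] by blast
  define N where "N = (real CARD('n))\<^sup>2"
  have N: "N > 0" by (simp add: N_def)
  have T: "texp H0 > 0" by (rule texp_pos[OF H0])
  \<comment> \<open>The first bound keeps the change of the exponent within the factor exp \<delta>,
    the second keeps the change of the tangent within \<open>\<delta> * texp H0\<close>; the added 1
    guards against \<open>g * norm a = 0\<close>.\<close>
  define r where "r = min (\<delta> / (N * (1 + g))) (\<delta> * texp H0 / (g * norm a + 1))"
  define m where "m = exp \<delta> * ((1 + \<delta>) * texp H0)"
  have r: "0 < r" unfolding r_def using \<delta> N T g0
    by (auto intro!: divide_pos_pos mult_pos_pos add_nonneg_pos)
  have r1: "N * ((1 + g) * r) \<le> \<delta>"
  proof -
    have "r \<le> \<delta> / (N * (1 + g))" by (simp add: r_def)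
    moreover have "0 < N * (1 + g)" using N g0 by simp
    ultimately have "r * (N * (1 + g)) \<le> \<delta>" by (simp only: pos_le_divide_eq)
    then show ?thesis by (simp only: mult_ac)
  qed
  have r2: "g * norm a * r \<le> \<delta> * texp H0"
  proof -
    have "r \<le> \<delta> * texp H0 / (g * norm a + 1)" by (simp add: r_def)
    moreover have "g * norm a + 1 > 0" using g0 by (intro add_nonneg_pos) auto
    ultimately have "(g * norm a + 1) * r \<le> \<delta> * texp H0" by (simp add: field_simps)
    then show ?thesis using r by (simp add: algebra_simps)
  qed
  show ?thesis
  proof (intro exI conjI allI impI)
    show "0 < r" by (rule r)
    show "0 \<le> m" using \<delta> T by (simp add: m_def)
    fix H V :: "'n cmat" assume HV: "(H, V) \<in> ball (H0, V0) r \<and> self_adjoint H \<and> psd V"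
    then have sa: "self_adjoint H" "self_adjoint V" by (auto simp: psd_def)
    have dist: "norm (H0 - H) \<le> r" "norm (V0 - V) \<le> r"
      using HV dist_fst_le[of "(H0, V0)" "(H, V)"] dist_snd_le[of "(H0, V0)" "(H, V)"]
      by (auto simp: dist_norm)
    have "N * norm (H0 - H) \<le> N * ((1 + g) * r)"
      using dist(1) N g0 r by (intro mult_left_mono) (auto simp: algebra_simps intro: add_increasing2)
    then have e: "exp (N * norm (H0 - H)) \<le> exp \<delta>" using r1 by simp
    have "texp H0 \<le> exp (N * norm (H0 - H)) * texp H"
      using texp_herm_le[of H0 H] by (simp add: N_def herm_self_adjoint H0 sa)
    also have "\<dots> \<le> exp \<delta> * texp H"
      by (rule mult_right_mono[OF e]) (rule less_imp_le[OF texp_pos[OF sa(1)]])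
    finally have "m \<le> exp \<delta> * ((1 + \<delta>) * (exp \<delta> * texp H))"
      unfolding m_def using \<delta> by (intro mult_left_mono) auto
    moreover have "exp (2 * \<delta>) = exp \<delta> * exp \<delta>" by (simp flip: exp_add)
    ultimately show "m \<le> exp (2 * \<delta>) * (1 + \<delta>) * texp H" by (simp only: mult_ac)
    fix X :: "'n cmat" assume X: "self_adjoint X \<and> psd (R *\<^sub>R mat 1 - X)"
    let ?A = "H + \<theta> *\<^sub>R X - g *\<^sub>R V" and ?B = "H0 + \<theta> *\<^sub>R X - g *\<^sub>R V0"
    have AB: "self_adjoint ?A" "self_adjoint ?B"
      using X V0 H0 sa by (auto simp: psd_def intro!: self_adjoint_intros)
    have "norm (?A - ?B) \<le> norm (H0 - H) + norm (g *\<^sub>R (V0 - V))"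
    proof -
      have "?A - ?B = - (H0 - H) + g *\<^sub>R (V0 - V)" by (simp add: algebra_simps)
      then show ?thesis by (metis norm_minus_cancel norm_triangle_ineq)
    qed
    also have "\<dots> \<le> r + g * r" using dist g0 by (auto intro!: add_mono mult_left_mono)
    finally have "N * norm (?A - ?B) \<le> N * ((1 + g) * r)"
      using N by (intro mult_left_mono) (auto simp: algebra_simps)
    then have e: "exp (N * norm (?A - ?B)) \<le> exp \<delta>" using r1 by simp
    have "texp ?A \<le> exp (N * norm (?A - ?B)) * texp ?B"
      using texp_herm_le[of ?A ?B] by (simp only: N_def herm_self_adjoint AB)
    also have "\<dots> \<le> exp \<delta> * texp ?B"
      by (rule mult_right_mono[OF e]) (rule less_imp_le[OF texp_pos[OF AB(2)]])
    also have "\<dots> \<le> exp \<delta> * (texp H0 + a \<bullet> (\<theta> *\<^sub>R X + g *\<^sub>R (X ** X) - g *\<^sub>R V0))"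
      using a X by (intro mult_left_mono) auto
    also have "\<dots> \<le> exp \<delta> * ((1 + \<delta>) * texp H0 + a \<bullet> (\<theta> *\<^sub>R X + g *\<^sub>R (X ** X) - g *\<^sub>R V))"
    proof (rule mult_left_mono)
      have "a \<bullet> (g *\<^sub>R (V - V0)) \<le> norm a * norm (g *\<^sub>R (V - V0))" by (rule norm_cauchy_schwarz)
      also have "\<dots> = g * norm a * norm (V0 - V)" using g0 by (simp add: norm_minus_commute)
      also have "\<dots> \<le> g * norm a * r" using g0 dist by (intro mult_left_mono) auto
      finally have "a \<bullet> (g *\<^sub>R (V - V0)) \<le> \<delta> * texp H0" using r2 by linarith
      then show "texp H0 + a \<bullet> (\<theta> *\<^sub>R X + g *\<^sub>R (X ** X) - g *\<^sub>R V0)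
          \<le> (1 + \<delta>) * texp H0 + a \<bullet> (\<theta> *\<^sub>R X + g *\<^sub>R (X ** X) - g *\<^sub>R V)"
        by (simp add: inner_diff_right inner_add_right algebra_simps)
    qed simp
    finally show "texp ?A \<le> m + (exp \<delta> *\<^sub>R a) \<bullet> (\<theta> *\<^sub>R X + g *\<^sub>R (X ** X) - g *\<^sub>R V)"
      by (simp add: m_def algebra_simps)
  qed
qed

text \<open>The Lindelof property leaves countably many of the local sets. \<open>Q {}\<close>
  allows the empty set to be adjoined, so that an enumeration by the naturals exists in every
  case.\<close>

lemma countable_subcover_disjoint:
  fixes \<Gamma> :: "'a::second_countable_topology set"
  assumes loc: "\<And>x. x \<in> \<Gamma> \<Longrightarrow> \<exists>S. open S \<and> x \<in> S \<and> Q S" and Q: "Q {}"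
  obtains S :: "nat \<Rightarrow> 'a set" where "\<And>n. open (S n)" "\<And>n. Q (S n)"
    "\<Gamma> \<subseteq> (\<Union>n. disjointed S n)"
proof -
  define \<F> where "\<F> = {S. open S \<and> Q S}"
  obtain \<F>' where F': "\<F>' \<subseteq> \<F>" "countable \<F>'" "\<Union>\<F>' = \<Union>\<F>"
    using Lindelof[of \<F>] by (auto simp: \<F>_def)
  define S where "S = from_nat_into (insert {} \<F>')"
  have rng: "range S = insert {} \<F>'"
    unfolding S_def by (rule range_from_nat_into) (use F' in auto)
  then have S: "S n \<in> insert {} \<F>'" for n by blast
  show thesis
  proof (rule that)
    show "open (S n)" "Q (S n)" for n using S[of n] F'(1) Q by (auto simp: \<F>_def)
    have "\<Gamma> \<subseteq> \<Union>\<F>" using loc by (fastforce simp: \<F>_def)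
    also have "\<Union>\<F> = (\<Union>n. S n)" using F'(3) rng by auto
    finally show "\<Gamma> \<subseteq> (\<Union>n. disjointed S n)" by (simp add: UN_disjointed_eq)
  qed
qed

text \<open>A countable partition of the space of pairs \<open>(H, V)\<close> on which the tangent functional is
  constant replaces a measurable selection of the tangent.\<close>

lemma texp_conditional_decrease_approx:
  fixes X H :: "'a \<Rightarrow> 'n::finite cmat" and R \<theta> g \<delta> :: real
  assumes M: "prob_space M" and G: "subalgebra M G"
    and XG: "X \<in> borel_measurable M" and X: "integrable M X" and XX: "integrable M (\<lambda>\<omega>. X \<omega> ** X \<omega>)"
    and sa: "\<And>\<omega>. \<omega> \<in> space M \<Longrightarrow> self_adjoint (X \<omega>)"
    and mean: "AE \<omega> in M. mat_cond_exp M G X \<omega> = 0"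
    and bnd: "AE \<omega> in M. psd (R *\<^sub>R mat 1 - X \<omega>)"
    and HG: "H \<in> borel_measurable G" and Hsa: "AE \<omega> in M. self_adjoint (H \<omega>)"
    and R: "R > 0" and \<theta>: "\<theta> > 0" and g: "g = (exp (\<theta> * R) - \<theta> * R - 1) / R\<^sup>2"
    and \<delta>: "\<delta> > 0" and B: "B \<in> sets G"
    and V: "V = mat_cond_exp M G (\<lambda>\<omega>. X \<omega> ** X \<omega>)"
  shows "(\<integral>\<^sup>+\<omega>\<in>B. ennreal (texp (herm (H \<omega> + \<theta> *\<^sub>R X \<omega> - g *\<^sub>R V \<omega>))) \<partial>M)
    \<le> ennreal (exp (2 * \<delta>) * (1 + \<delta>)) * (\<integral>\<^sup>+\<omega>\<in>B. ennreal (texp (herm (H \<omega>))) \<partial>M)"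
proof -
  interpret prob_space M by fact
  \<comment> \<open>\<open>Q S\<close> says that one functional a and one constant m serve all
    admissible pairs in S.\<close>
  define Q where "Q S \<longleftrightarrow> (\<exists>a m. 0 \<le> m \<and> (\<forall>H V. (H, V) \<in> S \<and> self_adjoint H \<and> psd V \<longrightarrow>
      m \<le> exp (2 * \<delta>) * (1 + \<delta>) * texp H \<and>
      (\<forall>X. self_adjoint X \<and> psd (R *\<^sub>R mat 1 - X) \<longrightarrow>
        texp (H + \<theta> *\<^sub>R X - g *\<^sub>R V) \<le> m + a \<bullet> (\<theta> *\<^sub>R X + g *\<^sub>R (X ** X) - g *\<^sub>R V))))"
    for S :: "('n cmat \<times> 'n cmat) set"
  have "\<exists>S. open S \<and> x \<in> S \<and> Q S" if x: "x \<in> {(H, V). self_adjoint H \<and> psd V}" for x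
  proof -
    obtain H0 V0 where x': "x = (H0, V0)" "self_adjoint H0" "psd V0" using x by auto
    obtain r where r: "0 < r" "Q (ball (H0, V0) r)"
      using texp_increment_bound_local[OF x'(2,3) R \<theta> g \<delta>] unfolding Q_def by blast
    then show ?thesis using x'(1) by (intro exI[of _ "ball (H0, V0) r"]) auto
  qed
  moreover have "Q {}" unfolding Q_def by (intro exI[of _ 0]) auto
  ultimately obtain S where S: "\<And>n. open (S n)" "\<And>n. Q (S n)"
    and cover: "{(H, V). self_adjoint H \<and> psd V} \<subseteq> (\<Union>n. disjointed S n)"
    using countable_subcover_disjoint[of _ Q] by metis
  have VG [measurable]: "V \<in> borel_measurable G" unfolding V by (rule measurable_mat_cond_exp)
  note HG [measurable] B [measurable]
  have VM [measurable]: "V \<in> borel_measurable M" and HM [measurable]: "H \<in> borel_measurable M"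
    using measurable_from_subalg[OF G] VG HG by blast+
  note XG [measurable]
  have contM: "(\<lambda>\<omega>. texp (herm (f \<omega>))) \<in> borel_measurable M" if "f \<in> borel_measurable M" for f
    using borel_measurable_continuous_on[OF continuous_texp_herm that] .
  have subset: "A \<in> sets G \<Longrightarrow> A \<in> sets M" for A using G by (auto simp: subalgebra_def)
  \<comment> \<open>These pieces lie in G because H and V are G-measurable, so integrals over them
    do not change under conditioning on G.\<close>
  define E where "E n = B \<inter> {\<omega> \<in> space G. (H \<omega>, V \<omega>) \<in> disjointed S n}" for n
  have DS: "disjointed S n \<in> sets borel" for n
    unfolding disjointed_def using S(1) by (intro sets.Diff sets.finite_UN borel_open) auto
  have EG: "E n \<in> sets G" for n
  proof -
    have "(\<lambda>\<omega>. (H \<omega>, V \<omega>)) \<in> borel_measurable G" by measurable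
    from measurable_sets[OF this DS[of n]] show ?thesis
      unfolding E_def by (intro sets.Int B) (simp add: vimage_def Int_def conj_commute)
  qed
  have EM: "E n \<in> sets M" for n by (rule subset[OF EG])
  have disj: "disjoint_family E"
    using disjoint_family_disjointed[of S] by (fastforce simp: disjoint_family_on_def E_def)
  have psdV: "AE \<omega> in M. psd (V \<omega>)"
    unfolding V by (rule AE_psd_mat_cond_exp_square[OF M G XX sa])
  have inE: "AE \<omega> in M. \<omega> \<in> B \<longleftrightarrow> \<omega> \<in> (\<Union>n. E n)"
    using psdV Hsa AE_space
  proof eventually_elim
    case (elim \<omega>)
    then have "(H \<omega>, V \<omega>) \<in> (\<Union>n. disjointed S n)" using cover by auto
    moreover have "space G = space M" using G by (simp add: subalgebra_def)
    ultimately show ?case using elim by (auto simp: E_def)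
  qed
  let ?f = "\<lambda>\<omega>. ennreal (texp (herm (H \<omega> + \<theta> *\<^sub>R X \<omega> - g *\<^sub>R V \<omega>)))"
  let ?h = "\<lambda>\<omega>. ennreal (texp (herm (H \<omega>)))"
  let ?c = "exp (2 * \<delta>) * (1 + \<delta>)"
  have f [measurable]: "?f \<in> borel_measurable M" and h [measurable]: "?h \<in> borel_measurable M"
    by (intro measurable_compose[OF contM measurable_ennreal]; measurable)+
  \<comment> \<open>The functionals of different pieces have no common bound, so the tangent
    expressions need not be integrable over all of B. Each piece is settled with real integrals, and
    only nonnegative integrals are summed.\<close>
  have piece: "(\<integral>\<^sup>+\<omega>\<in>E n. ?f \<omega> \<partial>M) \<le> ennreal ?c * (\<integral>\<^sup>+\<omega>\<in>E n. ?h \<omega> \<partial>M)" for n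
  proof -
    obtain a m where m: "0 \<le> m"
      and am: "\<And>H V. (H, V) \<in> S n \<Longrightarrow> self_adjoint H \<Longrightarrow> psd V \<Longrightarrow> m \<le> ?c * texp H"
      "\<And>H V X. (H, V) \<in> S n \<Longrightarrow> self_adjoint H \<Longrightarrow> psd V \<Longrightarrow> self_adjoint X \<Longrightarrow>
        psd (R *\<^sub>R mat 1 - X) \<Longrightarrow>
        texp (H + \<theta> *\<^sub>R X - g *\<^sub>R V) \<le> m + a \<bullet> (\<theta> *\<^sub>R X + g *\<^sub>R (X ** X) - g *\<^sub>R V)"
      using S(2)[of n] unfolding Q_def by metis
    have ES: "\<omega> \<in> E n \<Longrightarrow> (H \<omega>, V \<omega>) \<in> S n" for \<omega>
      using disjointed_subset[of S n] by (auto simp: E_def)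
    \<comment> \<open>The tangent bound on piece n. Its integral over \<open>E n\<close> reduces to
      that of m: the X term has conditional mean zero, and the terms in X^2 and V cancel.\<close>
    define L where "L \<omega> = m + (\<theta> * (a \<bullet> X \<omega>) + g * (a \<bullet> (X \<omega> ** X \<omega>)) - g * (a \<bullet> V \<omega>))" for \<omega>
    have iV: "integrable M (\<lambda>\<omega>. a \<bullet> V \<omega>)"
      unfolding V by (rule integrable_inner_mat_cond_exp[OF M G XX])
    have iX: "integrable M (\<lambda>\<omega>. a \<bullet> X \<omega>)" "integrable M (\<lambda>\<omega>. a \<bullet> (X \<omega> ** X \<omega>))"
      by (intro integrable_inner_right impI X XX)+
    have iL: "integrable M (\<lambda>\<omega>. indicator (E n) \<omega> * L \<omega>)"
      unfolding L_def
      by (rule integrable_real_mult_indicator[OF EM, unfolded mult.commute[of "_ :: real" "indicator _ _"]])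
        (intro Bochner_Integration.integrable_add Bochner_Integration.integrable_diff
          integrable_mult_right iV iX, simp)
    have sX: "(LINT \<omega>:E n|M. a \<bullet> X \<omega>) = 0"
    proof -
      have "(LINT \<omega>:E n|M. a \<bullet> X \<omega>) = (LINT \<omega>:E n|M. a \<bullet> mat_cond_exp M G X \<omega>)"
        by (rule set_integral_inner_mat_cond_exp[OF M G X EG, symmetric])
      also have "\<dots> = (\<integral>\<omega>. 0 \<partial>M)"
        unfolding set_lebesgue_integral_def
        by (intro integral_cong_AE)
          (use mean measurable_from_subalg[OF G measurable_mat_cond_exp[of M G X]] EM in auto)
      finally show ?thesis by simp
    qed
    have sV: "(LINT \<omega>:E n|M. a \<bullet> V \<omega>) = (LINT \<omega>:E n|M. a \<bullet> (X \<omega> ** X \<omega>))"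
      unfolding V by (rule set_integral_inner_mat_cond_exp[OF M G XX EG])
    note si = set_integrable_of_integrable[OF EM]
    have "(\<integral>\<omega>. indicator (E n) \<omega> * L \<omega> \<partial>M) = (LINT \<omega>:E n|M. L \<omega>)"
      by (simp add: set_lebesgue_integral_def)
    also have "\<dots> = (LINT \<omega>:E n|M. m)"
      unfolding L_def
      by (simp add: set_integral_add set_integral_diff set_integral_mult_right si iV iX sX sV
          integrable_mult_right)
    also have "\<dots> = m * measure M (E n)"
      using EM by (simp add: set_lebesgue_integral_def)
    finally have intL: "(\<integral>\<omega>. indicator (E n) \<omega> * L \<omega> \<partial>M) = m * measure M (E n)" .
    have f_le_L: "(\<integral>\<^sup>+\<omega>\<in>E n. ?f \<omega> \<partial>M) \<le> (\<integral>\<^sup>+\<omega>. ennreal (indicator (E n) \<omega> * L \<omega>) \<partial>M)"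
      and Lpos: "AE \<omega> in M. 0 \<le> indicator (E n) \<omega> * L \<omega>"
    proof -
      have *: "AE \<omega> in M. ?f \<omega> * indicator (E n) \<omega> \<le> ennreal (indicator (E n) \<omega> * L \<omega>) \<and>
          0 \<le> indicator (E n) \<omega> * L \<omega>"
        using psdV Hsa bnd AE_space
      proof eventually_elim
        case (elim \<omega>)
        show ?case
        proof (cases "\<omega> \<in> E n")
          case True
          have saA: "self_adjoint (H \<omega> + \<theta> *\<^sub>R X \<omega> - g *\<^sub>R V \<omega>)"
            using elim sa by (auto simp: psd_def intro!: self_adjoint_intros)
          have "texp (H \<omega> + \<theta> *\<^sub>R X \<omega> - g *\<^sub>R V \<omega>) \<le> L \<omega>"
            using am(2)[OF ES[OF True], of "X \<omega>"] elim sa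
            by (simp add: L_def inner_diff_right inner_add_right)
          then show ?thesis
            using True texp_pos[OF saA] by (simp add: herm_self_adjoint[OF saA] ennreal_leI)
        qed simp
      qed
      then show "(\<integral>\<^sup>+\<omega>\<in>E n. ?f \<omega> \<partial>M) \<le> (\<integral>\<^sup>+\<omega>. ennreal (indicator (E n) \<omega> * L \<omega>) \<partial>M)"
        by (intro nn_integral_mono_AE) auto
      show "AE \<omega> in M. 0 \<le> indicator (E n) \<omega> * L \<omega>" using * by auto
    qed
    note f_le_L
    also have "(\<integral>\<^sup>+\<omega>. ennreal (indicator (E n) \<omega> * L \<omega>) \<partial>M) = ennreal (m * measure M (E n))"
      using nn_integral_eq_integral[OF iL Lpos] by (simp add: intL)
    also have "\<dots> = (\<integral>\<^sup>+\<omega>\<in>E n. ennreal m \<partial>M)"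
      using m EM by (simp add: nn_integral_cmult_indicator emeasure_eq_measure ennreal_mult)
    also have "\<dots> \<le> (\<integral>\<^sup>+\<omega>. ennreal ?c * (?h \<omega> * indicator (E n) \<omega>) \<partial>M)"
    proof (rule nn_integral_mono_AE)
      show "AE \<omega> in M. ennreal m * indicator (E n) \<omega> \<le> ennreal ?c * (?h \<omega> * indicator (E n) \<omega>)"
        using psdV Hsa
      proof eventually_elim
        case (elim \<omega>)
        show ?case
        proof (cases "\<omega> \<in> E n")
          case True
          then have "ennreal m \<le> ennreal (?c * texp (H \<omega>))"
            by (intro ennreal_leI am(1)[OF ES]) (use elim in auto)
          then show ?thesis
            using True elim \<delta> texp_pos[of "H \<omega>"] by (simp add: herm_self_adjoint ennreal_mult)
        qed simp
      qed
    qed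
    also have "\<dots> = ennreal ?c * (\<integral>\<^sup>+\<omega>\<in>E n. ?h \<omega> \<partial>M)"
      by (rule nn_integral_cmult) (use EM in measurable)
    finally show ?thesis .
  qed
  have split: "(\<integral>\<^sup>+\<omega>\<in>B. k \<omega> \<partial>M) = (\<Sum>n. (\<integral>\<^sup>+\<omega>\<in>E n. k \<omega> \<partial>M))"
    if k: "k \<in> borel_measurable M" for k
  proof -
    have "(\<integral>\<^sup>+\<omega>\<in>B. k \<omega> \<partial>M) = (\<integral>\<^sup>+\<omega>\<in>(\<Union>n. E n). k \<omega> \<partial>M)"
      by (rule nn_integral_cong_AE) (use inE in eventually_elim, auto split: split_indicator)
    then show ?thesis using nn_integral_disjoint_family[OF k EM disj] by simp
  qed
  have "(\<integral>\<^sup>+\<omega>\<in>B. ?f \<omega> \<partial>M) \<le> (\<Sum>n. ennreal ?c * (\<integral>\<^sup>+\<omega>\<in>E n. ?h \<omega> \<partial>M))"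
    unfolding split[OF f] by (intro suminf_le piece summableI)
  also have "\<dots> = ennreal ?c * (\<integral>\<^sup>+\<omega>\<in>B. ?h \<omega> \<partial>M)"
    unfolding split[OF h] by (rule ennreal_suminf_cmult)
  finally show ?thesis .
qed

text \<open>The limit \<delta> to 0 is taken in the reals. Once y is finite, the hypothesis at
  \<delta> = 1 shows that x is finite too.\<close>

lemma le_of_le_exp_mult:
  fixes x y :: ennreal
  assumes "\<And>\<delta>. \<delta> > 0 \<Longrightarrow> x \<le> ennreal (exp (2 * \<delta>) * (1 + \<delta>)) * y"
  shows "x \<le> y"
proof (cases "y = \<top>")
  case False
  then obtain r where r: "y = ennreal r" "0 \<le> r" by (cases y) auto
  have "x \<le> ennreal (exp (2 * 1) * (1 + 1)) * y" using assms[of 1] by simp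
  also have "\<dots> < \<top>" unfolding r by (simp add: ennreal_mult[symmetric] r)
  finally obtain l where l: "x = ennreal l" "0 \<le> l" by (cases x) auto
  have "l \<le> exp (2 * \<delta>) * (1 + \<delta>) * r" if "\<delta> > 0" for \<delta>
    using assms[OF that] that r unfolding l r
    by (simp add: ennreal_mult[symmetric])
  then have "l \<le> exp (2 * inverse (real (Suc n))) * (1 + inverse (real (Suc n))) * r" for n by simp
  moreover have "(\<lambda>n. exp (2 * inverse (real (Suc n))) * (1 + inverse (real (Suc n))) * r)
      \<longlonglongrightarrow> exp (2 * 0) * (1 + 0) * r"
    by (intro tendsto_intros LIMSEQ_inverse_real_of_nat)
  ultimately have "l \<le> r" using LIMSEQ_le_const by fastforce
  then show ?thesis unfolding l r by (rule ennreal_leI)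
qed simp

text \<open>Doob's maximal argument with integrals over sets of the filtration instead of
  conditional expectations and stopping times: at each time the points where Z has reached c are
  split off, and only the rest is carried forward.\<close>

lemma supermartingale_maximal:
  fixes Z :: "nat \<Rightarrow> 'a \<Rightarrow> real"
  assumes F: "\<And>k. subalgebra M (F k)" and mono: "\<And>k. sets (F k) \<subseteq> sets (F (Suc k))"
    and Z: "\<And>k. Z k \<in> borel_measurable (F k)"
    and decr: "\<And>k B. B \<in> sets (F k) \<Longrightarrow>
      (\<integral>\<^sup>+\<omega>\<in>B. ennreal (Z (Suc k) \<omega>) \<partial>M) \<le> (\<integral>\<^sup>+\<omega>\<in>B. ennreal (Z k \<omega>) \<partial>M)"
  shows "ennreal c * emeasure M {\<omega> \<in> space M. \<exists>k. c \<le> Z k \<omega>} \<le> (\<integral>\<^sup>+\<omega>. ennreal (Z 0 \<omega>) \<partial>M)"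
proof -
  have sp: "space (F k) = space M" and sub: "sets (F k) \<subseteq> sets M" for k
    using F by (auto simp: subalgebra_def)
  have ZM [measurable]: "Z k \<in> borel_measurable M" for k
    using measurable_from_subalg[OF F Z] .
  have lt: "{\<omega> \<in> space M. Z k \<omega> < c} \<in> sets (F k)" for k
    using borel_measurable_less[OF Z[of k] borel_measurable_const[of c]] by (simp add: sp)
  define G where "G N = {\<omega> \<in> space M. \<forall>k\<le>N. Z k \<omega> < c}" for N
  have GSuc: "G (Suc N) = G N \<inter> {\<omega> \<in> space M. Z (Suc N) \<omega> < c}" for N
    by (auto simp: G_def le_Suc_eq)
  have GF: "G N \<in> sets (F N)" for N
  proof (induction N)
    case 0
    then show ?case using lt[of 0] by (simp add: G_def)
  next
    case (Suc N)
    then show ?case unfolding GSuc using mono lt by blast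
  qed
  have GM: "G N \<in> sets M" for N using GF sub by blast
  \<comment> \<open>Markov's inequality on the part of U where \<open>Z k\<close> has reached c,
    with the integral over the rest retained.\<close>
  have split: "ennreal c * emeasure M (U \<inter> {\<omega> \<in> space M. c \<le> Z k \<omega>})
      + (\<integral>\<^sup>+\<omega>\<in>U \<inter> {\<omega> \<in> space M. Z k \<omega> < c}. ennreal (Z k \<omega>) \<partial>M)
      \<le> (\<integral>\<^sup>+\<omega>\<in>U. ennreal (Z k \<omega>) \<partial>M)" if [measurable]: "U \<in> sets M" for U k
  proof -
    have "ennreal c * emeasure M (U \<inter> {\<omega> \<in> space M. c \<le> Z k \<omega>})
      + (\<integral>\<^sup>+\<omega>\<in>U \<inter> {\<omega> \<in> space M. Z k \<omega> < c}. ennreal (Z k \<omega>) \<partial>M)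
      = (\<integral>\<^sup>+\<omega>. ennreal c * indicator (U \<inter> {\<omega> \<in> space M. c \<le> Z k \<omega>}) \<omega>
          + ennreal (Z k \<omega>) * indicator (U \<inter> {\<omega> \<in> space M. Z k \<omega> < c}) \<omega> \<partial>M)"
      by (subst nn_integral_add) (auto simp: nn_integral_cmult_indicator)
    also have "\<dots> \<le> (\<integral>\<^sup>+\<omega>\<in>U. ennreal (Z k \<omega>) \<partial>M)"
      by (intro nn_integral_mono) (auto split: split_indicator intro: ennreal_leI)
    finally show ?thesis .
  qed
  \<comment> \<open>The invariant charges c for each point that has crossed by time N and keeps the
    integral over \<open>G N\<close>, where no crossing has occurred; the kept integral feeds the
    next step.\<close>
  have ind: "ennreal c * emeasure M {\<omega> \<in> space M. \<exists>k\<le>N. c \<le> Z k \<omega>}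
      + (\<integral>\<^sup>+\<omega>\<in>G N. ennreal (Z N \<omega>) \<partial>M) \<le> (\<integral>\<^sup>+\<omega>. ennreal (Z 0 \<omega>) \<partial>M)" for N
  proof (induction N)
    case 0
    have "(\<integral>\<^sup>+\<omega>\<in>space M. ennreal (Z 0 \<omega>) \<partial>M) = (\<integral>\<^sup>+\<omega>. ennreal (Z 0 \<omega>) \<partial>M)"
      by (intro nn_integral_cong) simp
    moreover have "G 0 = space M \<inter> {\<omega> \<in> space M. Z 0 \<omega> < c}"
      "{\<omega> \<in> space M. \<exists>k\<le>0. c \<le> Z k \<omega>} = space M \<inter> {\<omega> \<in> space M. c \<le> Z 0 \<omega>}"
      by (auto simp: G_def)
    ultimately show ?case using split[of "space M" 0] by simp
  next
    case (Suc N)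
    let ?P = "\<lambda>N. {\<omega> \<in> space M. \<exists>k\<le>N. c \<le> Z k \<omega>}"
    let ?A = "G N \<inter> {\<omega> \<in> space M. c \<le> Z (Suc N) \<omega>}"
    have "?P (Suc N) = ?P N \<union> ?A" by (auto simp: G_def le_Suc_eq not_le)
    moreover have "?P N \<inter> ?A = {}" by (auto simp: G_def not_less[symmetric])
    moreover have "?P N \<in> sets M" by measurable
    moreover have "?A \<in> sets M" using GM[of N] by measurable
    ultimately have "emeasure M (?P (Suc N)) = emeasure M (?P N) + emeasure M ?A"
      by (simp add: plus_emeasure)
    then have "ennreal c * emeasure M (?P (Suc N)) + (\<integral>\<^sup>+\<omega>\<in>G (Suc N). ennreal (Z (Suc N) \<omega>) \<partial>M)
        = ennreal c * emeasure M (?P N)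
          + (ennreal c * emeasure M ?A + (\<integral>\<^sup>+\<omega>\<in>G (Suc N). ennreal (Z (Suc N) \<omega>) \<partial>M))"
      by (simp only: distrib_left add.assoc)
    also have "\<dots> \<le> ennreal c * emeasure M (?P N) + (\<integral>\<^sup>+\<omega>\<in>G N. ennreal (Z (Suc N) \<omega>) \<partial>M)"
      unfolding GSuc by (intro add_left_mono split GM)
    also have "\<dots> \<le> ennreal c * emeasure M (?P N) + (\<integral>\<^sup>+\<omega>\<in>G N. ennreal (Z N \<omega>) \<partial>M)"
      by (intro add_left_mono decr GF)
    finally show ?case using Suc.IH by (rule order_trans)
  qed
  let ?P = "\<lambda>N. {\<omega> \<in> space M. \<exists>k\<le>N. c \<le> Z k \<omega>}"
  have "{\<omega> \<in> space M. \<exists>k. c \<le> Z k \<omega>} = (\<Union>N. ?P N)" by auto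
  moreover have "(SUP N. emeasure M (?P N)) = emeasure M (\<Union>N. ?P N)"
    by (rule SUP_emeasure_incseq) (auto simp: incseq_def intro: order_trans)
  ultimately have "ennreal c * emeasure M {\<omega> \<in> space M. \<exists>k. c \<le> Z k \<omega>}
      = ennreal c * (SUP N. emeasure M (?P N))" by simp
  also have "\<dots> = (SUP N. ennreal c * emeasure M (?P N))" by (rule SUP_mult_left_ennreal)
  also have "\<dots> \<le> (\<integral>\<^sup>+\<omega>. ennreal (Z 0 \<omega>) \<partial>M)"
  proof (rule SUP_least)
    fix N
    have "ennreal c * emeasure M (?P N) \<le> ennreal c * emeasure M (?P N)
        + (\<integral>\<^sup>+\<omega>\<in>G N. ennreal (Z N \<omega>) \<partial>M)" by simp
    then show "ennreal c * emeasure M (?P N) \<le> (\<integral>\<^sup>+\<omega>. ennreal (Z 0 \<omega>) \<partial>M)"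
      using ind by (rule order_trans)
  qed
  finally show ?thesis .
qed

text \<open>This initial value of the process is the source of the dimension factor in the final
  bound.\<close>

lemma texp_zero: "texp (0 :: 'n::finite cmat) = real CARD('n)"
proof -
  have U: "unitary (mat 1 :: 'n cmat)" by (simp add: unitary_def)
  have "(0 :: 'n cmat) = mat 1 ** dg (\<lambda>i. 0) ** adj (mat 1)" by (simp add: vec_eq_iff dg_def)
  then have "texp (0 :: 'n cmat) = texp (mat 1 ** dg (\<lambda>i. 0) ** adj (mat 1 :: 'n cmat))" by simp
  then show ?thesis by (simp only: texp_spectral[OF U]) simp
qed

text \<open>A single null set serves all k, as the event to be bounded ranges over all
  times.\<close>

lemma AE_self_adjoint_quadratic_variation:
  fixes X :: "nat \<Rightarrow> 'a \<Rightarrow> 'n::finite cmat"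
  assumes M: "prob_space M" and F: "\<And>k. subalgebra M (F k)"
    and sa: "\<And>k \<omega>. k \<ge> 1 \<Longrightarrow> \<omega> \<in> space M \<Longrightarrow> self_adjoint (X k \<omega>)"
    and XX: "\<And>k. k \<ge> 1 \<Longrightarrow> integrable M (\<lambda>\<omega>. X k \<omega> ** X k \<omega>)"
  shows "AE \<omega> in M. \<forall>k. self_adjoint (quadratic_variation M F X k \<omega>)"
proof -
  have "AE \<omega> in M. self_adjoint (mat_cond_exp M (F (j - 1)) (\<lambda>\<omega>. X j \<omega> ** X j \<omega>) \<omega>)" if "j \<ge> 1" for j
    by (rule AE_self_adjoint_mat_cond_exp[OF M F XX[OF that]]) (intro self_adjoint_square sa that)
  then have "AE \<omega> in M. \<forall>j. j \<ge> 1 \<longrightarrow>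
      self_adjoint (mat_cond_exp M (F (j - 1)) (\<lambda>\<omega>. X j \<omega> ** X j \<omega>) \<omega>)"
    by (simp add: AE_all_countable)
  then show ?thesis
    by eventually_elim (auto simp: quadratic_variation_def intro!: self_adjoint_sum)
qed

theorem theorem3p1:
  fixes M :: "'a measure" and F :: "nat \<Rightarrow> 'a measure"
    and X :: "nat \<Rightarrow> 'a \<Rightarrow> complex ^ 'n::finite ^ 'n"
    and R t \<sigma> :: real
  assumes "prob_space M"
    and "filtration (space M) F" and "\<And>k. subalgebra M (F k)"
    and adapted: "\<And>k. k \<ge> 1 \<Longrightarrow> X k \<in> borel_measurable (F k)"
    and self_adj: "\<And>k \<omega>. k \<ge> 1 \<Longrightarrow> \<omega> \<in> space M \<Longrightarrow> self_adjoint (X k \<omega>)"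
    and integrable: "\<And>k. k \<ge> 1 \<Longrightarrow> integrable M (X k)"
    and square_integrable: "\<And>k. k \<ge> 1 \<Longrightarrow> integrable M (\<lambda>\<omega>. X k \<omega> ** X k \<omega>)"
    and "R > 0"
    and mean_zero: "\<And>k. k \<ge> 1 \<Longrightarrow> AE \<omega> in M. mat_cond_exp M (F (k - 1)) (X k) \<omega> = 0"
    and bounded: "\<And>k. k \<ge> 1 \<Longrightarrow> AE \<omega> in M. lambda_max (X k \<omega>) \<le> R"
    and "t \<ge> 0" and "\<sigma>\<^sup>2 > 0"
  shows "\<P>(\<omega> in M. \<exists>k\<ge>0. lambda_max (partial_sum X k \<omega>) \<ge> t
                       \<and> spectral_norm (quadratic_variation M F X k \<omega>) \<le> \<sigma>\<^sup>2)
         \<le> real CARD('n) * exp (- (\<sigma>\<^sup>2 / R\<^sup>2) * h (R * t / \<sigma>\<^sup>2))"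
proof -
  interpret prob_space M by fact
  note F = \<open>\<And>k. subalgebra M (F k)\<close> and R = \<open>R > 0\<close>
  let ?Y = "partial_sum X" and ?W = "quadratic_variation M F X"
  let ?E = "{\<omega> \<in> space M. \<exists>k\<ge>0. lambda_max (?Y k \<omega>) \<ge> t \<and> spectral_norm (?W k \<omega>) \<le> \<sigma>\<^sup>2}"
  show ?thesis
  \<comment> \<open>At t = 0 the choice of \<theta> would be 0, while the one-step bound asks for
    \<theta> > 0. The claimed bound is then the dimension, since h vanishes at 0.\<close>
  proof (cases "t = 0")
    case True
    have "1 \<le> real CARD('n)" by simp
    then have "prob ?E \<le> real CARD('n)" using prob_le_1[of ?E] by linarith
    then show ?thesis by (simp add: True h_def)
  next
    case False
    then have t: "t > 0" using \<open>t \<ge> 0\<close> by simp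
    define u where "u = R * t / \<sigma>\<^sup>2"
    have u: "u > 0" using t R \<open>\<sigma>\<^sup>2 > 0\<close> by (simp add: u_def)
    \<comment> \<open>This solves \<open>exp (\<theta> * R) = 1 + u\<close>, the stationarity
      condition for \<open>g * \<sigma>\<^sup>2 - \<theta> * t\<close> as a function of
      \<theta>.\<close>
    define \<theta> where "\<theta> = ln (1 + u) / R"
    have \<theta>: "\<theta> > 0" using u R by (simp add: \<theta>_def)
    define g where "g = (exp (\<theta> * R) - \<theta> * R - 1) / R\<^sup>2"
    have g': "g = (u - ln (1 + u)) / R\<^sup>2" using u R by (simp add: g_def \<theta>_def)
    have g0: "g \<ge> 0" using ln_add_one_self_le_self[of u] u by (simp add: g')
    define c where "c = exp (\<theta> * t - g * \<sigma>\<^sup>2)"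
    have c: "c = exp (\<sigma>\<^sup>2 / R\<^sup>2 * h (R * t / \<sigma>\<^sup>2))"
    proof -
      have tu: "t = u * \<sigma>\<^sup>2 / R" using R \<open>\<sigma>\<^sup>2 > 0\<close> by (simp add: u_def)
      have "\<theta> * t - g * \<sigma>\<^sup>2 = \<sigma>\<^sup>2 / R\<^sup>2 * h u"
        unfolding g' h_def tu \<theta>_def using R by (simp add: field_simps power2_eq_square)
      then show ?thesis by (simp add: c_def u_def)
    qed
    define Z where "Z k \<omega> = texp (herm (\<theta> *\<^sub>R ?Y k \<omega> - g *\<^sub>R ?W k \<omega>))" for k \<omega>
    have FF: "sets (F i) \<subseteq> sets (F j)" if "i \<le> j" for i j
      using filtration.sets_F_mono[OF \<open>filtration (space M) F\<close> that] .
    have sp: "space (F k) = space M" for k using F by (simp add: subalgebra_def)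
    have lift: "f \<in> borel_measurable (F j)" if "f \<in> borel_measurable (F i)" "i \<le> j"
      for f :: "'a \<Rightarrow> 'n cmat" and i j
      using measurable_from_subalg[of "F j" "F i" f borel] that FF[OF that(2)] by (simp add: subalgebra_def sp)
    have Ym: "?Y k \<in> borel_measurable (F k)" for k
      unfolding partial_sum_def by (intro borel_measurable_sum lift[OF adapted]) auto
    have Wm: "?W k \<in> borel_measurable (F k)" for k
      unfolding quadratic_variation_def
      by (intro borel_measurable_sum lift[OF measurable_mat_cond_exp]) auto
    have Hm: "(\<lambda>\<omega>. \<theta> *\<^sub>R ?Y k \<omega> - g *\<^sub>R ?W k \<omega>) \<in> borel_measurable (F k)" for k
      by (intro borel_measurable_diff borel_measurable_scaleR borel_measurable_const Ym Wm)
    have Zm: "Z k \<in> borel_measurable (F k)" for k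
      unfolding Z_def by (rule borel_measurable_continuous_on[OF continuous_texp_herm Hm])
    have Ysa: "self_adjoint (?Y k \<omega>)" if "\<omega> \<in> space M" for k \<omega>
      unfolding partial_sum_def by (rule self_adjoint_sum) (simp add: self_adj that)
    have Wsa: "AE \<omega> in M. \<forall>k. self_adjoint (?W k \<omega>)"
      by (rule AE_self_adjoint_quadratic_variation) (fact assms self_adj F square_integrable)+
    have decr: "(\<integral>\<^sup>+\<omega>\<in>B. ennreal (Z (Suc k) \<omega>) \<partial>M) \<le> (\<integral>\<^sup>+\<omega>\<in>B. ennreal (Z k \<omega>) \<partial>M)"
      if B: "B \<in> sets (F k)" for k B
    proof (rule le_of_le_exp_mult)
      fix \<delta> :: real assume \<delta>: "\<delta> > 0"
      \<comment> \<open>Index \<open>Suc k\<close> is conditioned on \<open>F k\<close>, so the past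
        exponent and the new compensator term V are both \<open>F k\<close>-measurable, and the
        one-step estimate applies with \<open>F k\<close> as its sigma-algebra.\<close>
      define V where "V = mat_cond_exp M (F k) (\<lambda>\<omega>. X (Suc k) \<omega> ** X (Suc k) \<omega>)"
      have psdX: "AE \<omega> in M. psd (R *\<^sub>R mat 1 - X (Suc k) \<omega>)"
        using bounded[of "Suc k"] AE_space
        by (auto simp: self_adj lambda_max_le_imp_psd elim!: eventually_elim2)
      have Hsa: "AE \<omega> in M. self_adjoint (\<theta> *\<^sub>R ?Y k \<omega> - g *\<^sub>R ?W k \<omega>)"
        using Wsa AE_space by eventually_elim (intro self_adjoint_intros Ysa; simp)
      have "Z (Suc k) \<omega> = texp (herm (\<theta> *\<^sub>R ?Y k \<omega> - g *\<^sub>R ?W k \<omega> + \<theta> *\<^sub>R X (Suc k) \<omega> - g *\<^sub>R V \<omega>))" for \<omega>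
        by (simp add: Z_def V_def partial_sum_def quadratic_variation_def algebra_simps)
      moreover have "(\<integral>\<^sup>+\<omega>\<in>B. ennreal (texp (herm (\<theta> *\<^sub>R ?Y k \<omega> - g *\<^sub>R ?W k \<omega> + \<theta> *\<^sub>R X (Suc k) \<omega> - g *\<^sub>R V \<omega>))) \<partial>M)
        \<le> ennreal (exp (2 * \<delta>) * (1 + \<delta>)) * (\<integral>\<^sup>+\<omega>\<in>B. ennreal (texp (herm (\<theta> *\<^sub>R ?Y k \<omega> - g *\<^sub>R ?W k \<omega>))) \<partial>M)"
        by (rule texp_conditional_decrease_approx[OF prob_space_axioms F _ _ _ _ _ psdX Hm Hsa R \<theta> g_def \<delta> B V_def])
          (use integrable[of "Suc k"] square_integrable[of "Suc k"] self_adj[of "Suc k"]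
            mean_zero[of "Suc k"] in auto)
      ultimately show "(\<integral>\<^sup>+\<omega>\<in>B. ennreal (Z (Suc k) \<omega>) \<partial>M)
          \<le> ennreal (exp (2 * \<delta>) * (1 + \<delta>)) * (\<integral>\<^sup>+\<omega>\<in>B. ennreal (Z k \<omega>) \<partial>M)"
        by (simp add: Z_def)
    qed
    have Z0: "Z 0 \<omega> = real CARD('n)" for \<omega>
      by (simp add: Z_def partial_sum_def quadratic_variation_def herm_self_adjoint
          self_adjoint_zero texp_zero)
    let ?A = "{\<omega> \<in> space M. \<exists>k. c \<le> Z k \<omega>}"
    have "ennreal c * emeasure M ?A \<le> (\<integral>\<^sup>+\<omega>. ennreal (Z 0 \<omega>) \<partial>M)"
      by (rule supermartingale_maximal[where F = F and Z = Z]) (rule F FF Zm decr; simp)+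
    also have "\<dots> = ennreal (real CARD('n))" by (simp add: Z0 emeasure_space_1)
    finally have "c * measure M ?A \<le> real CARD('n)"
      by (simp add: emeasure_eq_measure c_def ennreal_mult[symmetric])
    then have A: "measure M ?A \<le> real CARD('n) / c" by (simp add: c_def field_simps)
    have [measurable]: "Z k \<in> borel_measurable M" for k
      using measurable_from_subalg[OF F Zm] .
    have AM: "?A \<in> sets M" by measurable
    \<comment> \<open>The inclusion is obtained only almost surely, because self-adjointness of the
      compensator is known only outside a null set.\<close>
    have "measure M ?E \<le> measure M ?A"
    proof (cases "?E \<in> sets M")
      case True
      have "AE \<omega> in M. \<omega> \<in> ?E \<longrightarrow> \<omega> \<in> ?A"
        using Wsa AE_space
      proof eventually_elim
        case (elim \<omega>)
        show ?case
        proof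
          assume "\<omega> \<in> ?E"
          then obtain k where k: "t \<le> lambda_max (?Y k \<omega>)" "spectral_norm (?W k \<omega>) \<le> \<sigma>\<^sup>2" by auto
          have sa: "self_adjoint (?Y k \<omega>)" "self_adjoint (?W k \<omega>)" using elim Ysa by auto
          have "c \<le> texp (\<theta> *\<^sub>R ?Y k \<omega> - g *\<^sub>R ?W k \<omega>)"
            unfolding c_def by (intro texp_ge_on_event sa k less_imp_le[OF \<theta>] g0)
          also have "\<dots> = Z k \<omega>"
            unfolding Z_def by (subst herm_self_adjoint) (intro self_adjoint_intros sa, rule refl)
          finally show "\<omega> \<in> ?A" using elim by auto
        qed
      qed
      then show ?thesis by (rule finite_measure_mono_AE[OF _ AM])
    next
      case False
      \<comment> \<open>\<open>measure\<close> is 0 outside the sigma-algebra, so measurability of the event need not be shown.\<close>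
      then show ?thesis by (simp add: measure_notin_sets)
    qed
    also note A
    also have "real CARD('n) / c = real CARD('n) * exp (- (\<sigma>\<^sup>2 / R\<^sup>2) * h (R * t / \<sigma>\<^sup>2))"
      by (simp add: c exp_minus divide_inverse)
    finally show ?thesis .
  qed
qed

end
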